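(* Let $K$ and $L$ be compact lines. A continuous increasing surjection $\phi:K\to L$ has the $c_0$-extension property if and only if the following condition holds: for every separable $G_\delta$ subset $A$ of $L$, if every point of $A$ is a two-sided limit point of $A$ (relatively to $L$), then $A\cap Q(\phi)=A\cap Q_0(\phi)$ is countable.
   Context: A compact line is a linearly ordered set which is compact in its order topology. "Increasing" means order-preserving in the weak sense ($s\le t$ implies $\phi(s)\le\phi(t)$). "Countable" means finite or countably infinite. For a compact Hausdorff space $K$, $C(K)$ is the Banach space of continuous real-valued functions on $K$ with the supremum norm. A closed subspace $Y$ of a Banach space $X$ has the $c_0$-extension property in $X$ if every bounded operator $Y\to c_0$ admits a bounded extension $X\to c_0$. For a continuous increasing surjection $\phi:K\to L$ between compact lines, let $\phi^*:C(L)\to C(K)$, $\phi^*(f)=f\circ\phi$, with range $\phi^*C(L)$; $\phi$ is said to have the $c_0$-extension property if $\phi^*C(L)$ has the $c_0$-extension property in $C(K)$. Let $X$ be a linearly ordered set and $A\subset X$. A point $x\in X$ is a right limit point of $A$ (relatively to $X$) if $x$ is not the maximum of $X$ and for every $y\in X$ with $y>x$ the set $]x,y[\,\cap A$ is nonempty; left limit points are defined symmetrically (with the minimum of $X$ and points $y<x$). A two-sided limit point is a point that is both a left and a right limit point. A point of $X$ is internal if it is a two-sided limit point of $X$. Define $Q(\phi)=\{t\in L: |\phi^{-1}(t)|>1\}$ and $Q_0(\phi)=\{t\in Q(\phi): t \text{ is an internal point of } L\}$. *)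

theory Defs
  imports "HOL-Analysis.Analysis"
begin

(* A compact line is a type of class linorder_topology (a linear order with its order topology)
   whose UNIV is compact.  On such a type every continuous real function is bounded, so C(K) with
   the supremum norm is the type 'k \<Rightarrow>\<^sub>C real. *)

(* The library has completeness of bcontfun only over a metric domain, so these function spaces are
   not in class banach here. *)
lemma complete_bcontfun_UNIV:
  "complete (UNIV :: ('k::topological_space \<Rightarrow>\<^sub>C real) set)"
  unfolding complete_def
proof (intro allI impI)
  fix f :: "nat \<Rightarrow> 'k \<Rightarrow>\<^sub>C real"
  assume "(\<forall>n. f n \<in> UNIV) \<and> Cauchy f"
  then have "Cauchy f" by simp
  then have "uniformly_Cauchy_on UNIV (\<lambda>n. apply_bcontfun (f n))"
    unfolding uniformly_Cauchy_on_def Cauchy_def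
    by (meson dist_fun_lt_imp_dist_val_lt)
  then have "uniformly_convergent_on UNIV (\<lambda>n. apply_bcontfun (f n))"
    by (rule Cauchy_uniformly_convergent)
  then obtain g where g: "uniform_limit UNIV (\<lambda>n. apply_bcontfun (f n)) g sequentially"
    by (auto simp: uniformly_convergent_on_def)
  obtain h where "f \<longlonglongrightarrow> h"
    by (rule uniform_limit_bcontfunE[OF g]) auto
  then show "\<exists>l\<in>UNIV. f \<longlonglongrightarrow> l" by auto
qed

section \<open>The \<open>c\<^sub>0\<close>-extension property\<close>

(* c_0 as a closed subspace of l_infinity, the bounded functions on the discrete space nat. *)
definition c0 :: "(nat \<Rightarrow>\<^sub>C real) set" where
  "c0 = {x. apply_bcontfun x \<longlonglongrightarrow> 0}"

(* The library's bounded_linear speaks about whole types only. *)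
definition bounded_operator_on ::
    "'x::real_normed_vector set \<Rightarrow> 'y::real_normed_vector set \<Rightarrow> ('x \<Rightarrow> 'y) \<Rightarrow> bool" where
  "bounded_operator_on Y Z T \<longleftrightarrow>
     T ` Y \<subseteq> Z \<and>
     (\<forall>x\<in>Y. \<forall>y\<in>Y. T (x + y) = T x + T y) \<and>
     (\<forall>r. \<forall>x\<in>Y. T (r *\<^sub>R x) = r *\<^sub>R T x) \<and>
     (\<exists>B. \<forall>x\<in>Y. norm (T x) \<le> norm x * B)"

lemma bounded_operator_on_UNIV:
  "bounded_operator_on UNIV Z T \<longleftrightarrow> bounded_linear T \<and> range T \<subseteq> Z"
  by (auto simp: bounded_operator_on_def bounded_linear_def bounded_linear_axioms_def
      linear_iff)

(* Meant for closed subspaces Y of the ambient Banach space 'x. *)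
definition c0_extension_property :: "'x::real_normed_vector set \<Rightarrow> bool" where
  "c0_extension_property Y \<longleftrightarrow>
     (\<forall>T. bounded_operator_on Y c0 T \<longrightarrow>
        (\<exists>S. bounded_operator_on UNIV c0 S \<and> (\<forall>y\<in>Y. S y = T y)))"

(* The operator \<phi>\<^sup>*; Bcontfun is only meaningful here when \<phi> is continuous. *)
definition pullback ::
    "('k::topological_space \<Rightarrow> 'l::topological_space) \<Rightarrow> ('l \<Rightarrow>\<^sub>C real) \<Rightarrow> ('k \<Rightarrow>\<^sub>C real)" where
  "pullback \<phi> f = Bcontfun (apply_bcontfun f \<circ> \<phi>)"

lemma apply_pullback:
  assumes "continuous_on UNIV \<phi>"
  shows "apply_bcontfun (pullback \<phi> f) x = apply_bcontfun f (\<phi> x)"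
proof -
  have "continuous_on UNIV (apply_bcontfun f \<circ> \<phi>)"
    using assms by (intro continuous_on_compose) auto
  moreover have "bounded (range (apply_bcontfun f \<circ> \<phi>))"
    by (rule bounded_subset[OF bounded_apply_bcontfun[of f]]) auto
  ultimately show ?thesis
    by (simp add: pullback_def Bcontfun_inverse bcontfun_def)
qed

lemma norm_pullback:
  assumes "continuous_on UNIV \<phi>" "surj \<phi>"
  shows "norm (pullback \<phi> f) = norm f"
proof (rule antisym)
  show "norm (pullback \<phi> f) \<le> norm f"
    by (rule norm_bound) (metis apply_pullback assms(1) norm_bounded)
  have "norm (apply_bcontfun f y) \<le> norm (pullback \<phi> f)" for y
    by (metis apply_pullback assms norm_bounded surjD)
  then show "norm f \<le> norm (pullback \<phi> f)"
    by (rule norm_bound)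
qed

lemma bounded_linear_pullback:
  assumes "continuous_on UNIV \<phi>" "surj \<phi>"
  shows "bounded_linear (pullback \<phi>)"
  by (rule bounded_linear_intro[where K = 1])
     (auto intro!: bcontfun_eqI simp: apply_pullback norm_pullback assms)

lemma closed_subspace_range_pullback:
  assumes "continuous_on UNIV \<phi>" "surj \<phi>"
  shows "subspace (range (pullback \<phi>))" "closed (range (pullback \<phi>))"
proof -
  interpret bounded_linear "pullback \<phi>"
    by (rule bounded_linear_pullback[OF assms])
  show "subspace (range (pullback \<phi>))"
    by (intro linear_subspace_image linear_axioms subspace_UNIV)
  have "complete (pullback \<phi> ` UNIV)"
    by (rule complete_isometric_image[of 1])
       (auto simp: norm_pullback assms complete_bcontfun_UNIV bounded_linear_pullback)
  then show "closed (range (pullback \<phi>))"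
    by (rule complete_imp_closed)
qed

definition map_c0_extension_property ::
    "('k::topological_space \<Rightarrow> 'l::topological_space) \<Rightarrow> bool" where
  "map_c0_extension_property \<phi> \<longleftrightarrow> c0_extension_property (range (pullback \<phi>))"

section \<open>Limit points in linear orders\<close>

(* All limit points are relative to the whole linearly ordered type. *)
definition right_limit_point :: "'a::linorder set \<Rightarrow> 'a \<Rightarrow> bool" where
  "right_limit_point A x \<longleftrightarrow> (\<exists>y. x < y) \<and> (\<forall>y>x. {x<..<y} \<inter> A \<noteq> {})"

definition left_limit_point :: "'a::linorder set \<Rightarrow> 'a \<Rightarrow> bool" where
  "left_limit_point A x \<longleftrightarrow> (\<exists>y. y < x) \<and> (\<forall>y<x. {y<..<x} \<inter> A \<noteq> {})"

definition two_sided_limit_point :: "'a::linorder set \<Rightarrow> 'a \<Rightarrow> bool" where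
  "two_sided_limit_point A x \<longleftrightarrow> left_limit_point A x \<and> right_limit_point A x"

definition internal_point :: "'a::linorder \<Rightarrow> bool" where
  "internal_point x \<longleftrightarrow> two_sided_limit_point UNIV x"

definition Q :: "('k \<Rightarrow> 'l) \<Rightarrow> 'l set" where
  "Q \<phi> = {t. \<exists>x\<in>\<phi> -` {t}. \<exists>y\<in>\<phi> -` {t}. x \<noteq> y}"

definition Q0 :: "('k \<Rightarrow> 'l::linorder) \<Rightarrow> 'l set" where
  "Q0 \<phi> = {t \<in> Q \<phi>. internal_point t}"

end

theory Submission
  imports Defs
begin

text \<open>
  An operator \<open>C(L) \<rightarrow> c\<^sub>0\<close> is a pointwise null sequence of functionals \<open>\<mu> n\<close> on \<open>C(L)\<close>, and extending
  it means to find extensions \<open>\<nu> n\<close> to \<open>C(K)\<close> that are uniformly bounded and still form a pointwise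
  null sequence.  For \<open>t \<in> Q \<phi>\<close> let \<open>jump t\<close> be a function on \<open>K\<close> that increases from 0 to 1 inside
  the fibre over \<open>t\<close>.  What can go wrong is that the \<open>\<nu> n\<close> do not tend to 0 on some of these
  functions.

  The key observation is that a single functional on \<open>C(K)\<close> can charge only countably many fibres.
  For all other \<open>t\<close> its value on \<open>jump t\<close> is the limit, as \<open>s\<close> decreases (or increases) to \<open>t\<close>, of its
  values on continuous steps of \<open>L\<close> between \<open>t\<close> and \<open>s\<close>, so that it is dictated by \<open>\<mu> n\<close>
  (\<open>jump_eq_right_limit\<close>, \<open>jump_eq_left_limit\<close>).  A sequence of functionals charges only countably many
  fibres as well, and the question is whether a weak*-null sequence on \<open>L\<close> can take
  non-negligible values on steep steps at uncountably many points of \<open>Q \<phi>\<close>.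

  If \<open>A\<close> is a separable \<open>G\<^sub>\<delta>\<close> set all of whose points are two-sided limit points of \<open>A\<close>, there
  are intervals \<open>[a\<^sub>n, b\<^sub>n]\<close> such that every point of \<open>A\<close> outside a countable set lies in the interior
  of infinitely many of them, while no two points lie together in infinitely many
  (\<open>thin_intervals\<close>): run through covers of \<open>A\<close> by disjoint intervals inside smaller and smaller open
  sets, which avoid more and more points of a countable dense set.  Then \<open>f \<mapsto> (f(a\<^sub>n) - f(b\<^sub>n))\<^sub>n\<close> is an
  operator into \<open>c\<^sub>0\<close>, and it takes the value \<open>-1\<close> infinitely often on steep steps at almost every
  point of \<open>A\<close>.  So it has no extension if \<open>A \<inter> Q \<phi>\<close> is uncountable.

  Conversely, the points where infinitely many \<open>\<mu> n\<close> are at least \<open>\<epsilon>\<close> on all steps over an interval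
  around the point form a \<open>G\<^sub>\<delta>\<close> set.  Since the sequence is null, these intervals shrink, and
  every such point is a two-sided limit of the countably many places needed to detect the variation
  of all the \<open>\<mu> n\<close>.  Up to countably many points the set is therefore a separable \<open>G\<^sub>\<delta>\<close> set of the
  required kind (\<open>bad_set_core\<close>), and meets \<open>Q \<phi>\<close> in a countable set.  Starting from
  Hahn--Banach extensions \<open>\<nu> n\<close>, only countably many jumps are left on which the \<open>\<nu> n\<close> do not tend to
  0.  On finitely many jumps the \<open>\<nu> n\<close> are eventually bounded in sum, because the jumps differ from
  functions of \<open>C(L)\<close> by functions with disjoint supports; so one can subtract point masses at the
  ends of the fibres, for more and more of the jumps as \<open>n\<close> grows, without losing boundedness
  (\<open>extension_if_countable_jumps\<close>).
\<close>

section \<open>Compact lines and monotone step functions\<close>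

lemma compact_line_Sup:
  fixes S :: "'a::linorder_topology set"
  assumes "compact (UNIV :: 'a set)" "S \<noteq> {}"
  obtains m where "\<And>x. x \<in> S \<Longrightarrow> x \<le> m" "\<And>u. u < m \<Longrightarrow> \<exists>x\<in>S. u < x"
proof -
  have "compact (closure S)"
    using assms(1) compact_Int_closed[of UNIV "closure S"] by simp
  then obtain m where m: "m \<in> closure S" "\<And>x. x \<in> closure S \<Longrightarrow> x \<le> m"
    using compact_attains_sup[of "closure S"] assms(2) by auto
  have "\<exists>x\<in>S. u < x" if "u < m" for u
  proof -
    have "\<forall>T. u < m \<and> open T \<longrightarrow> m \<in> T \<longrightarrow> S \<inter> T \<noteq> {}"
      using m(1) by (meson IntI empty_iff closure_iff_nhds_not_empty order_refl)
    then show ?thesis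
      using that open_greaterThan[of u] by (metis disjoint_iff greaterThan_iff)
  qed
  moreover have "x \<le> m" if "x \<in> S" for x
    using m(2) closure_subset[of S] that by auto
  ultimately show thesis
    using that by metis
qed

lemma convex_nbhd:
  fixes u :: "'a::linorder_topology"
  assumes "open N" "u \<in> N"
  obtains C where "open C" "u \<in> C" "C \<subseteq> N" "\<forall>a\<in>C. \<forall>b\<in>C. {a..b} \<subseteq> C"
proof -
  obtain A where A: "open A" "u \<in> A" "\<And>x. x \<in> A \<Longrightarrow> x \<le> u \<Longrightarrow> x \<in> N"
    "\<And>a c. a \<in> A \<Longrightarrow> a \<le> c \<Longrightarrow> c \<in> A"
  proof (cases "\<exists>y. y < u")
    case True
    then obtain b where "b < u" "{b<..u} \<subseteq> N"
      using open_left[OF assms] by blast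
    then show thesis
      by (intro that[of "{b<..}"]) auto
  next
    case False
    then show thesis
      using assms(2) by (intro that[of UNIV]) (auto simp: order_le_less)
  qed
  obtain B where B: "open B" "u \<in> B" "\<And>x. x \<in> B \<Longrightarrow> u \<le> x \<Longrightarrow> x \<in> N"
    "\<And>a c. a \<in> B \<Longrightarrow> c \<le> a \<Longrightarrow> c \<in> B"
  proof (cases "\<exists>y. u < y")
    case True
    then obtain b where "u < b" "{u..<b} \<subseteq> N"
      using open_right[OF assms] by blast
    then show thesis
      by (intro that[of "{..<b}"]) auto
  next
    case False
    then show thesis
      using assms(2) by (intro that[of UNIV]) (auto simp: order_le_less)
  qed
  show thesis
  proof (rule that[of "A \<inter> B"])
    show "A \<inter> B \<subseteq> N"
      using A(3) B(3) by (meson IntE linear subsetI)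
    show "\<forall>a\<in>A \<inter> B. \<forall>b\<in>A \<inter> B. {a..b} \<subseteq> A \<inter> B"
      using A(4) B(4) by fastforce
  qed (use A B in auto)
qed

text \<open>The elementary test functions: monotone, 0 up to \<open>x\<close> and 1 from \<open>y\<close> on.  Monotonicity is
  what makes a step over \<open>[x, z]\<close> a convex combination of a step over \<open>[x, y]\<close> and one over
  \<open>[y, z]\<close>.\<close>

definition step :: "'a::linorder_topology \<Rightarrow> 'a \<Rightarrow> ('a \<Rightarrow>\<^sub>C real) \<Rightarrow> bool" where
  "step x y f \<longleftrightarrow> mono (apply_bcontfun f) \<and> (\<forall>u\<le>x. f u = 0) \<and> (\<forall>u\<ge>y. f u = 1)"

lemma step_range:
  assumes "step x y f"
  shows "0 \<le> apply_bcontfun f u" "apply_bcontfun f u \<le> 1"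
proof -
  have m: "a \<le> b \<Longrightarrow> apply_bcontfun f a \<le> apply_bcontfun f b" for a b
    using assms by (auto simp: step_def mono_def)
  show "0 \<le> apply_bcontfun f u"
    using m[of x u] assms unfolding step_def by (metis linear order_refl)
  show "apply_bcontfun f u \<le> 1"
    using m[of u y] assms unfolding step_def by (metis linear order_refl)
qed

lemma step_mono: "step x' y' f \<Longrightarrow> x \<le> x' \<Longrightarrow> y' \<le> y \<Longrightarrow> step x y f"
  by (auto simp: step_def)

lemma bcontfun_compact:
  assumes "compact (UNIV :: 'a::topological_space set)" "continuous_on UNIV (f :: 'a \<Rightarrow> real)"
  obtains g where "apply_bcontfun g = f"
proof -
  have "f \<in> bcontfun"
    using assms compact_continuous_image[of UNIV f] by (auto simp: bcontfun_def compact_imp_bounded)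
  then show thesis
    using that by (metis Bcontfun_inverse)
qed

text \<open>Compact lines are normal, so Urysohn's lemma gives a continuous function with the right
  values; its running supremum is still continuous, and monotone.\<close>

lemma step_exists:
  fixes x y :: "'a::linorder_topology"
  assumes K: "compact (UNIV :: 'a set)" and "x < y"
  obtains f where "step x y f"
proof -
  have "Hausdorff_space (euclidean :: 'a topology)"
    by (auto simp: Hausdorff_space_def disjnt_def) (metis hausdorff)
  then have "normal_space (euclidean :: 'a topology)"
    using K by (intro compact_Hausdorff_or_regular_imp_normal_space) (auto simp: compact_space_def)
  then obtain f where f: "continuous_map (euclidean :: 'a topology) (top_of_set {0..1::real}) f"
    "f ` {..x} \<subseteq> {0}" "f ` {y..} \<subseteq> {1}"
    by (rule Urysohn_lemma[where S = "{..x}" and T = "{y..}" and a = 0 and b = 1])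
       (use assms(2) in \<open>auto simp: disjnt_def\<close>)
  have cont: "continuous_on UNIV f" and r: "0 \<le> f u" "f u \<le> 1" for u
    using f(1) by (auto simp: continuous_map_in_subtopology)
  define F where "F u = Sup (f ` {..u})" for u
  have bdd: "bdd_above (f ` A)" for A
    using r by (auto intro!: bdd_aboveI[of _ 1])
  have up: "f w \<le> F u" if "w \<le> u" for w u
    unfolding F_def using that by (intro cSUP_upper bdd) auto
  have lst: "F u \<le> c" if "\<And>w. w \<le> u \<Longrightarrow> f w \<le> c" for u c
    unfolding F_def using that by (intro cSUP_least) auto
  have mono: "mono F"
    by (intro monoI lst up) auto
  have "continuous_on UNIV F"
  proof (clarsimp simp: continuous_on_topological)
    fix u B assume "open B" "F u \<in> B"
    then obtain e where e: "e > 0" "\<And>z. \<bar>z - F u\<bar> < e \<Longrightarrow> z \<in> B"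
      by (metis dist_real_def open_dist)
    have "open (f -` {f u - e/4 <..< f u + e/4})" "u \<in> f -` {f u - e/4 <..< f u + e/4}"
      using cont e by (auto intro: open_vimage)
    then obtain C where C: "open C" "u \<in> C" "C \<subseteq> f -` {f u - e/4 <..< f u + e/4}"
      "\<forall>a\<in>C. \<forall>b\<in>C. {a..b} \<subseteq> C"
      by (rule convex_nbhd)
    have small: "F b \<le> F a + e/2" if "a \<in> C" "b \<in> C" "a \<le> b" for a b
    proof (rule lst)
      fix w assume "w \<le> b"
      show "f w \<le> F a + e/2"
      proof (cases "w \<le> a")
        case True
        then show ?thesis using up[of w a] e by simp
      next
        case False
        then have "w \<in> C" using C(4) that \<open>w \<le> b\<close> by fastforce
        then have "f w < f u + e/4" "f u - e/4 < f a" using C(3) that by auto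
        then show ?thesis using up[of a a] by simp
      qed
    qed
    have "F v \<in> B" if "v \<in> C" for v
    proof (rule e(2))
      show "\<bar>F v - F u\<bar> < e"
        using small[of u v] small[of v u] that C(2) e(1) monoD[OF mono, of u v] monoD[OF mono, of v u]
        by (cases u v rule: le_cases) auto
    qed
    then show "\<exists>A. open A \<and> u \<in> A \<and> (\<forall>v. v \<in> A \<longrightarrow> F v \<in> B)"
      using C by blast
  qed
  then obtain g where g: "apply_bcontfun g = F"
    using bcontfun_compact[OF K] by blast
  have "F u = 0" if "u \<le> x" for u
  proof (rule antisym)
    have "f w = 0" if "w \<le> x" for w using f(2) that by (simp add: image_subset_iff)
    then show "F u \<le> 0" using that by (metis lst order_trans order_refl)
    show "0 \<le> F u" using up[of u u] r[of u] by simp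
  qed
  moreover have "F u = 1" if "y \<le> u" for u
  proof (rule antisym)
    show "F u \<le> 1" using r by (intro lst)
    have "f u = 1" using f(3) that by (simp add: image_subset_iff)
    then show "1 \<le> F u" using up[of u u] by simp
  qed
  ultimately have "step x y g"
    using mono by (simp add: step_def g)
  then show thesis by (rule that)
qed

text \<open>A weak Stone--Weierstrass theorem for compact lines.  The approximation is pushed from left to
  right: the points up to which it succeeds have a supremum, at which it still succeeds by
  continuity, and beyond which it could be continued, either inside a small neighbourhood or across
  a gap of the line.  Steps only have to be correct on \<open>E\<close>, and the approximation is only claimed
  there.\<close>

lemma steps_dense:
  fixes Z :: "('a::linorder_topology \<Rightarrow>\<^sub>C real) set"
  assumes K: "compact (UNIV :: 'a set)" and Z: "subspace Z"
    and const: "\<And>c. const_bcontfun c \<in> Z"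
    and steps: "\<And>x y. x < y \<Longrightarrow> \<exists>h\<in>Z. (\<forall>u. 0 \<le> apply_bcontfun h u \<and> apply_bcontfun h u \<le> 1) \<and>
        (\<forall>u\<in>E. (u \<le> x \<longrightarrow> h u = 0) \<and> (y \<le> u \<longrightarrow> h u = 1))"
    and e: "0 < (e::real)"
  shows "\<exists>h\<in>Z. \<forall>u\<in>E. \<bar>apply_bcontfun g u - apply_bcontfun h u\<bar> \<le> e"
proof -
  define R where "R x \<longleftrightarrow> (\<exists>h\<in>Z. (\<forall>u\<in>E. u \<le> x \<longrightarrow> \<bar>apply_bcontfun g u - apply_bcontfun h u\<bar> \<le> e) \<and>
      (\<forall>u\<in>E. x \<le> u \<longrightarrow> apply_bcontfun h u = g x))" for x
  have ext: "R y" if "R x" "x < y" and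
    near: "{x<..<y} = {} \<or> (\<forall>u\<in>{x..y}. \<bar>apply_bcontfun g u - g x\<bar> \<le> e/2)" for x y
  proof -
    obtain h where h: "h \<in> Z" "\<And>u. u \<in> E \<Longrightarrow> u \<le> x \<Longrightarrow> \<bar>apply_bcontfun g u - apply_bcontfun h u\<bar> \<le> e"
      "\<And>u. u \<in> E \<Longrightarrow> x \<le> u \<Longrightarrow> apply_bcontfun h u = g x"
      using \<open>R x\<close> unfolding R_def by blast
    obtain k where k: "k \<in> Z" "\<And>u. 0 \<le> apply_bcontfun k u" "\<And>u. apply_bcontfun k u \<le> 1"
      "\<And>u. u \<in> E \<Longrightarrow> u \<le> x \<Longrightarrow> apply_bcontfun k u = 0" "\<And>u. u \<in> E \<Longrightarrow> y \<le> u \<Longrightarrow> apply_bcontfun k u = 1"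
      using steps[OF \<open>x < y\<close>] by blast
    define h' where "h' = h + (g y - g x) *\<^sub>R k"
    have "h' \<in> Z"
      unfolding h'_def using h k Z by (intro subspace_add subspace_scale)
    moreover have "\<bar>apply_bcontfun g u - apply_bcontfun h' u\<bar> \<le> e" if "u \<in> E" "u \<le> y" for u
    proof -
      consider "u \<le> x" | "u = y" | "x < u" "u < y"
        using \<open>u \<le> y\<close> by (meson leI order_le_less)
      then show ?thesis
      proof cases
        case 1
        then show ?thesis using h k that by (simp add: h'_def)
      next
        case 2
        then show ?thesis using h(3)[of u] k(5)[of u] that e \<open>x < y\<close> by (simp add: h'_def)
      next
        case 3
        then have "\<bar>apply_bcontfun g u - g x\<bar> \<le> e/2" "\<bar>apply_bcontfun g y - g x\<bar> \<le> e/2"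
          using near by (metis atLeastAtMost_iff emptyE greaterThanLessThan_iff less_imp_le,
            metis \<open>x < y\<close> atLeastAtMost_iff emptyE greaterThanLessThan_iff less_imp_le order_refl)
        moreover have "\<bar>(apply_bcontfun g y - g x) * k u\<bar> \<le> \<bar>apply_bcontfun g y - g x\<bar>"
          unfolding abs_mult using k(2,3)[of u] by (simp add: mult_left_le)
        moreover have "apply_bcontfun g u - h' u = (g u - g x) - (g y - g x) * k u"
          using h(3)[of u] 3 that by (simp add: h'_def)
        ultimately show ?thesis by linarith
      qed
    qed
    moreover have "apply_bcontfun h' u = g y" if "u \<in> E" "y \<le> u" for u
      using h(3)[of u] k(5)[of u] that \<open>x < y\<close> by (simp add: h'_def)
    ultimately show ?thesis unfolding R_def by blast
  qed
  obtain m where m: "\<And>x::'a. m \<le> x"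
    using compact_attains_inf[OF K] by auto
  have "R m"
    unfolding R_def using const[of "g m"] e m by (intro bexI[of _ "const_bcontfun (g m)"]) (auto dest: antisym)
  obtain s where s: "\<And>x. x \<in> Collect R \<Longrightarrow> x \<le> s" "\<And>u. u < s \<Longrightarrow> \<exists>x\<in>Collect R. u < x"
    using compact_line_Sup[OF K, of "Collect R"] \<open>R m\<close> by blast
  have "open (apply_bcontfun g -` {g s - e/4 <..< g s + e/4})"
    "s \<in> apply_bcontfun g -` {g s - e/4 <..< g s + e/4}"
    using e by (auto intro: open_vimage)
  then obtain C where C: "open C" "s \<in> C" "C \<subseteq> apply_bcontfun g -` {g s - e/4 <..< g s + e/4}"
    "\<forall>a\<in>C. \<forall>b\<in>C. {a..b} \<subseteq> C"
    by (rule convex_nbhd)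
  have extC: "R y" if "R x" "x < y" "x \<in> C" "y \<in> C" for x y
  proof (rule ext[OF that(1,2)], rule disjI2, rule ballI)
    fix u assume "u \<in> {x..y}"
    then have "u \<in> C" using C(4) that(3,4) by blast
    then have "g s - e/4 < g u" "g u < g s + e/4" "g s - e/4 < g x" "g x < g s + e/4"
      using C(3) \<open>x \<in> C\<close> by auto
    then show "\<bar>apply_bcontfun g u - g x\<bar> \<le> e/2"
      by linarith
  qed
  have "R s"
  proof (rule ccontr)
    assume "\<not> R s"
    then have "m < s" using \<open>R m\<close> m by (metis order_le_less)
    then obtain b where b: "b < s" "{b<..s} \<subseteq> C"
      using open_left[OF C(1,2)] by blast
    then obtain x where "R x" "b < x" using s(2) by auto
    moreover have "x < s" using s(1)[of x] \<open>R x\<close> \<open>\<not> R s\<close> by (auto simp: order_le_less)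
    ultimately show False
      using extC[of x s] b C(2) \<open>\<not> R s\<close> by (meson greaterThanAtMost_iff less_imp_le subsetD)
  qed
  have max: "u \<le> s" for u
  proof (rule ccontr)
    assume "\<not> u \<le> s"
    then have "s < u" by simp
    then obtain b where b: "s < b" "{s..<b} \<subseteq> C"
      using open_right[OF C(1,2)] by blast
    show False
    proof (cases "{s<..<b} = {}")
      case True
      then show ?thesis using ext[OF \<open>R s\<close> \<open>s < b\<close>] s(1)[of b] b by auto
    next
      case False
      then obtain z where "s < z" "z < b" by auto
      then show ?thesis using extC[OF \<open>R s\<close> \<open>s < z\<close>] s(1)[of z] b C(2)
        by (metis atLeastLessThan_iff less_imp_le mem_Collect_eq not_le subsetD)
    qed
  qed
  show ?thesis using \<open>R s\<close> max unfolding R_def by blast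
qed

section \<open>Sublinear functionals and the Hahn--Banach theorem\<close>

text \<open>The inequality for positive scalars already forces equality, because it can be applied to the
  reciprocal as well.\<close>

definition sublinear :: "('v::real_vector \<Rightarrow> real) \<Rightarrow> bool" where
  "sublinear p \<longleftrightarrow> (\<forall>x y. p (x + y) \<le> p x + p y) \<and> (\<forall>c>0. \<forall>x. p (c *\<^sub>R x) \<le> c * p x)"

lemma sublinearD:
  assumes "sublinear p"
  shows "p (x + y) \<le> p x + p y" "0 < c \<Longrightarrow> p (c *\<^sub>R x) = c * p x" "p 0 = 0" "- p (- x) \<le> p x"
proof -
  show add: "p (x + y) \<le> p x + p y" for x y
    using assms by (simp add: sublinear_def)
  have le: "p (c *\<^sub>R x) \<le> c * p x" if "0 < c" for c x
    using assms that by (simp add: sublinear_def)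
  show eq: "p (c *\<^sub>R x) = c * p x" if "0 < c" for c x
    using le[OF that, of x] le[of "1 / c" "c *\<^sub>R x"] that by (simp add: field_simps)
  show z: "p 0 = 0"
    using eq[of 2 0] by simp
  show "- p (- x) \<le> p x"
    using add[of x "- x"] z by simp
qed

text \<open>Zorn's lemma gives a minimal sublinear functional \<open>q\<close>, and it is additive: comparing \<open>q\<close> with the sublinear functional
  \<open>x \<mapsto> inf\<^sub>t\<^sub>\<ge>\<^sub>0 (q (x + t a) - t q a)\<close>, which is at most \<open>q\<close>, gives \<open>q x \<le> q (x + a) - q a\<close>.\<close>

lemma linear_below_sublinear:
  fixes p :: "'v::real_vector \<Rightarrow> real"
  assumes p: "sublinear p"
  obtains q where "linear q" "\<And>x. q x \<le> p x"
proof -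
  define A where "A = {q. sublinear q \<and> q \<le> p}"
  have "\<exists>m\<in>A. \<forall>a\<in>A. a \<le> m \<longrightarrow> a = m"
  proof (rule predicate_Zorn)
    show "partial_order_on A (relation_of (\<lambda>a b. b \<le> a) A)"
      by (rule partial_order_on_relation_ofI) auto
    fix C assume C: "C \<in> Chains (relation_of (\<lambda>a b. b \<le> a) A)"
    then have CA: "q \<in> A" if "q \<in> C" for q
      using that by (auto simp: Chains_def relation_of_def)
    have tot: "q \<le> r \<or> r \<le> q" if "q \<in> C" "r \<in> C" for q r
      using that C by (auto simp: Chains_def relation_of_def)
    show "\<exists>u\<in>A. \<forall>a\<in>C. u \<le> a"
    proof (cases "C = {}")
      case True
      then show ?thesis using p by (auto simp: A_def)
    next
      case False
      define u where "u x = (INF q\<in>C. q x)" for x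
      have low: "bdd_below ((\<lambda>q. q x) ` C)" for x
      proof (rule bdd_belowI2)
        fix q assume "q \<in> C"
        then have "sublinear q" "q (- x) \<le> p (- x)" using CA by (auto simp: A_def le_fun_def)
        then show "- p (- x) \<le> q x" using sublinearD(4)[of q x] by linarith
      qed
      have ule: "u x \<le> q x" if "q \<in> C" for q x
        unfolding u_def using that by (intro cINF_lower low)
      have ug: "c \<le> u x" if "\<And>q. q \<in> C \<Longrightarrow> c \<le> q x" for c x
        unfolding u_def using that False by (intro cINF_greatest)
      have "u (x + y) \<le> u x + u y" for x y
      proof -
        have "u (x + y) \<le> q x + r y" if qr: "q \<in> C" "r \<in> C" for q r
        proof -
          obtain s where s: "s \<in> C" "s \<le> q" "s \<le> r" using tot[OF qr] qr by auto
          have "u (x + y) \<le> s x + s y"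
            using ule[OF s(1)] sublinearD(1)[of s x y] CA[OF s(1)] by (force simp: A_def intro: order_trans)
          also have "\<dots> \<le> q x + r y" using s by (intro add_mono) (auto simp: le_fun_def)
          finally show ?thesis .
        qed
        then have "u (x + y) - r y \<le> u x" if "r \<in> C" for r
          using that by (intro ug) (simp add: algebra_simps)
        then have "u (x + y) - u x \<le> u y"
          by (intro ug) (simp add: algebra_simps)
        then show ?thesis by simp
      qed
      moreover have "u (c *\<^sub>R x) \<le> c * u x" if "0 < c" for c x
      proof -
        have "u (c *\<^sub>R x) / c \<le> q x" if "q \<in> C" for q
          using ule[OF that, of "c *\<^sub>R x"] sublinearD(2)[of q c x] CA[OF that] \<open>0 < c\<close>
          by (simp add: A_def field_simps)
        then have "u (c *\<^sub>R x) / c \<le> u x" by (rule ug)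
        then show ?thesis using \<open>0 < c\<close> by (simp add: field_simps)
      qed
      moreover have "u \<le> p"
      proof (rule le_funI)
        fix x
        obtain q where "q \<in> C" using False by blast
        then show "u x \<le> p x" using ule[of q x] CA[of q] by (auto simp: A_def le_fun_def intro: order_trans)
      qed
      ultimately have "u \<in> A" by (simp add: A_def sublinear_def)
      then show ?thesis using ule by (intro bexI[of _ u]) (auto simp: le_fun_def)
    qed
  qed
  then obtain q where "q \<in> A" and qmin: "\<forall>a\<in>A. a \<le> q \<longrightarrow> a = q"
    by blast
  then have q: "sublinear q" "q \<le> p"
    by (auto simp: A_def)
  have min: "r = q" if "sublinear r" "r \<le> q" for r
    using qmin that q(2) order_trans[of r q p] by (auto simp: A_def)
  have scale: "q (t *\<^sub>R a) = t * q a" if "0 \<le> t" for t a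
    using that sublinearD(2,3)[OF q(1)] by (cases "t = 0") auto
  have "q x + q a \<le> q (x + a)" for x a
  proof -
    define r where "r x = (INF t\<in>{0..}. q (x + t *\<^sub>R a) - t * q a)" for x
    have low: "bdd_below ((\<lambda>t. q (x + t *\<^sub>R a) - t * q a) ` {0..})" for x
    proof (rule bdd_belowI2)
      fix t :: real assume "t \<in> {0..}"
      then show "- q (- x) \<le> q (x + t *\<^sub>R a) - t * q a"
        using sublinearD(1)[OF q(1), of "x + t *\<^sub>R a" "- x"] scale[of t a] by simp
    qed
    have rle: "r x \<le> q (x + t *\<^sub>R a) - t * q a" if "0 \<le> t" for t x
      unfolding r_def using that by (intro cINF_lower low) auto
    have rg: "c \<le> r x" if "\<And>t. 0 \<le> t \<Longrightarrow> c \<le> q (x + t *\<^sub>R a) - t * q a" for c x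
      unfolding r_def using that by (intro cINF_greatest) auto
    have "r (x + y) \<le> r x + r y" for x y
    proof -
      have "r (x + y) \<le> (q (x + s *\<^sub>R a) - s * q a) + (q (y + t *\<^sub>R a) - t * q a)"
        if "0 \<le> s" "0 \<le> t" for s t
        using rle[of "s + t" "x + y"] that sublinearD(1)[OF q(1), of "x + s *\<^sub>R a" "y + t *\<^sub>R a"]
        by (simp add: algebra_simps)
      then have "r (x + y) - (q (y + t *\<^sub>R a) - t * q a) \<le> r x" if "0 \<le> t" for t
        using that by (intro rg) (simp add: algebra_simps)
      then have "r (x + y) - r x \<le> r y"
        by (intro rg) (simp add: algebra_simps)
      then show ?thesis by simp
    qed
    moreover have "r (c *\<^sub>R x) \<le> c * r x" if "0 < c" for c x
    proof -
      have "r (c *\<^sub>R x) / c \<le> q (x + t *\<^sub>R a) - t * q a" if "0 \<le> t" for t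
        using rle[of "c * t" "c *\<^sub>R x"] that \<open>0 < c\<close> sublinearD(2)[OF q(1) \<open>0 < c\<close>, of "x + t *\<^sub>R a"]
        by (simp add: field_simps)
      then have "r (c *\<^sub>R x) / c \<le> r x" by (rule rg)
      then show ?thesis using \<open>0 < c\<close> by (simp add: field_simps)
    qed
    moreover have "r \<le> q"
      using rle[of 0] by (simp add: le_fun_def)
    ultimately have "r = q" by (intro min) (simp_all add: sublinear_def)
    then show ?thesis using rle[of 1 x] by simp
  qed
  then have add: "q (x + y) = q x + q y" for x y
    using sublinearD(1)[OF q(1)] by (simp add: antisym)
  have neg: "q (- x) = - q x" for x
    using add[of x "- x"] sublinearD(3)[OF q(1)] by simp
  have "q (c *\<^sub>R x) = c *\<^sub>R q x" for c x
  proof (cases "0 \<le> c")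
    case False
    then have "q ((- c) *\<^sub>R x) = (- c) * q x" by (intro scale) auto
    then show ?thesis using neg[of "c *\<^sub>R x"] by simp
  qed (simp add: scale)
  then have "linear q" using add by (simp add: linear_iff)
  then show thesis using that q(2) by (simp add: le_fun_def)
qed

lemma Hahn_Banach:
  fixes p :: "'v::real_vector \<Rightarrow> real" and j :: "'y::real_vector \<Rightarrow> 'v" and m :: "'y \<Rightarrow> real"
  assumes p: "sublinear p" and j: "linear j" and m: "linear m" and mp: "\<And>y. m y \<le> p (j y)"
  obtains q where "linear q" "\<And>x. q x \<le> p x" "\<And>y. q (j y) = m y"
proof -
  define r where "r x = (INF y. p (x - j y) + m y)" for x
  have low: "bdd_below (range (\<lambda>y. p (x - j y) + m y))" for x
  proof (rule bdd_belowI2)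
    fix y
    show "- p (- x) \<le> p (x - j y) + m y"
      using sublinearD(1)[OF p, of "- x" "x - j y"] mp[of "- y"]
      by (simp add: linear_neg[OF j] linear_neg[OF m])
  qed
  have rle: "r x \<le> p (x - j y) + m y" for x y
    unfolding r_def by (intro cINF_lower low) auto
  have rg: "c \<le> r x" if "\<And>y. c \<le> p (x - j y) + m y" for c x
    unfolding r_def using that by (intro cINF_greatest) auto
  have "r (x + y) \<le> r x + r y" for x y
  proof -
    have "r (x + y) \<le> (p (x - j s) + m s) + (p (y - j t) + m t)" for s t
      using rle[of "x + y" "s + t"] sublinearD(1)[OF p, of "x - j s" "y - j t"]
      by (simp add: linear_add[OF j] linear_add[OF m] algebra_simps)
    then have "r (x + y) - (p (y - j t) + m t) \<le> r x" for t
      by (intro rg) (simp add: algebra_simps)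
    then have "r (x + y) - r x \<le> r y"
      by (intro rg) (simp add: algebra_simps)
    then show ?thesis by simp
  qed
  moreover have "r (c *\<^sub>R x) \<le> c * r x" if "0 < c" for c x
  proof -
    have "r (c *\<^sub>R x) / c \<le> p (x - j y) + m y" for y
    proof -
      have "r (c *\<^sub>R x) \<le> p (c *\<^sub>R (x - j y)) + c * m y"
        using rle[of "c *\<^sub>R x" "c *\<^sub>R y"] by (simp add: linear_scale[OF j] linear_scale[OF m] scaleR_diff_right)
      then have "r (c *\<^sub>R x) \<le> c * (p (x - j y) + m y)"
        using \<open>0 < c\<close> by (simp only: sublinearD(2)[OF p] distrib_left)
      then show ?thesis
        using \<open>0 < c\<close> by (simp add: field_simps)
    qed
    then have "r (c *\<^sub>R x) / c \<le> r x" by (rule rg)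
    then show ?thesis using \<open>0 < c\<close> by (simp add: field_simps)
  qed
  ultimately have "sublinear r" by (simp add: sublinear_def)
  then obtain q where q: "linear q" "\<And>x. q x \<le> r x"
    by (rule linear_below_sublinear) auto
  have le: "q (j y) \<le> m y" for y
    using q(2)[of "j y"] rle[of "j y" y] sublinearD(3)[OF p] by simp
  show thesis
  proof (rule that[OF q(1)])
    show "q x \<le> p x" for x
      using q(2)[of x] rle[of x 0] by (simp add: linear_0[OF j] linear_0[OF m])
    show "q (j y) = m y" for y
      using le[of y] le[of "- y"] by (simp add: linear_neg[OF j] linear_neg[OF m] linear_neg[OF q(1)])
  qed
qed

section \<open>The variation of a functional on a set\<close>

definition variation :: "(('a::topological_space \<Rightarrow>\<^sub>C real) \<Rightarrow> real) \<Rightarrow> 'a set \<Rightarrow> real" where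
  "variation \<nu> S = Sup {\<nu> f | f. norm f \<le> 1 \<and> (\<forall>x. x \<notin> S \<longrightarrow> apply_bcontfun f x = 0)}"

lemma variation_upper:
  assumes "bounded_linear \<nu>" "norm f \<le> 1" "\<And>x. x \<notin> S \<Longrightarrow> apply_bcontfun f x = 0"
  shows "\<nu> f \<le> variation \<nu> S"
proof -
  obtain B where B: "\<And>f. \<bar>\<nu> f\<bar> \<le> norm f * B" "0 < B"
    using bounded_linear.pos_bounded[OF assms(1)] by auto
  have "\<nu> f \<le> B" if "norm f \<le> 1" for f
    using B(1)[of f] mult_right_mono[of "norm f" 1 B] that B(2) by linarith
  then show ?thesis
    unfolding variation_def using assms(2,3) by (intro cSup_upper bdd_aboveI[of _ B]) auto
qed

text \<open>Functions with disjoint supports add up without increasing the supremum norm, so the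
  variation is superadditive.  A functional that does not vanish over an interval therefore makes a
  monotone real function increase there, which turns countability questions about functionals into
  questions about real functions.\<close>

lemma variation_add:
  assumes \<nu>: "bounded_linear \<nu>" and "S \<inter> S' = {}" "S \<subseteq> T" "S' \<subseteq> T"
    and g: "norm g \<le> 1" "\<And>x. x \<notin> S' \<Longrightarrow> apply_bcontfun g x = 0"
  shows "variation \<nu> S + \<bar>\<nu> g\<bar> \<le> variation \<nu> T"
proof -
  interpret bounded_linear \<nu> by fact
  define h where "h = (if 0 \<le> \<nu> g then g else - g)"
  have h: "norm h \<le> 1" "\<And>x. x \<notin> S' \<Longrightarrow> apply_bcontfun h x = 0" "\<nu> h = \<bar>\<nu> g\<bar>"
    using g by (auto simp: h_def neg)
  have "variation \<nu> S \<le> variation \<nu> T - \<bar>\<nu> g\<bar>"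
    unfolding variation_def[of \<nu> S]
  proof (rule cSup_least)
    show "{\<nu> f |f. norm f \<le> 1 \<and> (\<forall>x. x \<notin> S \<longrightarrow> apply_bcontfun f x = 0)} \<noteq> {}"
      by (auto intro!: exI[of _ 0])
    fix v assume "v \<in> {\<nu> f |f. norm f \<le> 1 \<and> (\<forall>x. x \<notin> S \<longrightarrow> apply_bcontfun f x = 0)}"
    then obtain f where f: "v = \<nu> f" "norm f \<le> 1" "\<And>x. x \<notin> S \<Longrightarrow> apply_bcontfun f x = 0"
      by blast
    have "norm (f + h) \<le> 1"
    proof (rule norm_bound)
      fix x
      show "norm (apply_bcontfun (f + h) x) \<le> 1"
      proof (cases "x \<in> S")
        case True
        then have "apply_bcontfun h x = 0" using assms(2) h(2) by auto
        then show ?thesis using norm_bounded[of f x] f(2) by simp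
      next
        case False
        then show ?thesis using norm_bounded[of h x] f(3) h(1) by simp
      qed
    qed
    moreover have "apply_bcontfun (f + h) x = 0" if "x \<notin> T" for x
    proof -
      have "x \<notin> S" "x \<notin> S'" using assms(3,4) that by auto
      then show ?thesis by (simp add: f(3) h(2))
    qed
    ultimately have "\<nu> (f + h) \<le> variation \<nu> T"
      by (rule variation_upper[OF \<nu>])
    then show "v \<le> variation \<nu> T - \<bar>\<nu> g\<bar>"
      by (simp add: add f h)
  qed
  then show ?thesis by simp
qed

lemma variation_mono:
  assumes "bounded_linear \<nu>" "S \<subseteq> T"
  shows "variation \<nu> S \<le> variation \<nu> T"
  using variation_add[OF assms(1), of S "{}" T 0] assms(2) by simp

section \<open>Jumps of real functions on a linear order\<close>

text \<open>A jump at \<open>t\<close> leaves room for a rational number that belongs to \<open>t\<close> alone.\<close>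

lemma countable_right_jumps:
  fixes w :: "'a::linorder \<Rightarrow> real"
  shows "countable {t. \<exists>\<delta>>0. \<forall>s>t. w t + \<delta> \<le> w s}" (is "countable ?J")
proof -
  have "\<exists>q::rat. w t < of_rat q \<and> (\<forall>s>t. of_rat q < w s)" if tJ: "t \<in> ?J" for t
  proof -
    obtain \<delta> where "\<delta> > 0" "\<forall>s>t. w t + \<delta> \<le> w s" using tJ by blast
    moreover obtain q where "w t < of_rat q" "of_rat q < w t + \<delta>"
      using of_rat_dense[of "w t" "w t + \<delta>"] \<open>\<delta> > 0\<close> by auto
    ultimately show ?thesis by (intro exI[of _ q]) force
  qed
  then obtain q :: "'a \<Rightarrow> rat"
    where q: "\<forall>t\<in>?J. w t < of_rat (q t) \<and> (\<forall>s>t. of_rat (q t) < w s)"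
    using bchoice[of ?J "\<lambda>t q. w t < of_rat q \<and> (\<forall>s>t. of_rat q < w s)"] by blast
  have less: "q s < q t" if "s \<in> ?J" "t \<in> ?J" "s < t" for s t
  proof -
    have "(of_rat (q s) :: real) < of_rat (q t)"
      using q that less_trans[of "of_rat (q s)" "w t" "of_rat (q t)"] by blast
    then show ?thesis by (simp add: of_rat_less)
  qed
  have "inj_on q ?J"
  proof (rule inj_onI)
    fix s t assume "s \<in> ?J" "t \<in> ?J" "q s = q t"
    then show "s = t"
      using less[of s t] less[of t s] by (cases s t rule: linorder_cases) simp_all
  qed
  then show ?thesis
    by (rule countable_image_inj_on[OF countableI_type])
qed

lemma countable_left_jumps:
  fixes w :: "'a::linorder \<Rightarrow> real"
  shows "countable {t. \<exists>\<delta>>0. \<forall>s<t. w s + \<delta> \<le> w t}" (is "countable ?J")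
proof -
  have "\<exists>q::rat. of_rat q < w t \<and> (\<forall>s<t. w s < of_rat q)" if tJ: "t \<in> ?J" for t
  proof -
    obtain \<delta> where "\<delta> > 0" "\<forall>s<t. w s + \<delta> \<le> w t" using tJ by blast
    moreover obtain q where "w t - \<delta> < of_rat q" "of_rat q < w t"
      using of_rat_dense[of "w t - \<delta>" "w t"] \<open>\<delta> > 0\<close> by auto
    ultimately show ?thesis by (intro exI[of _ q]) force
  qed
  then obtain q :: "'a \<Rightarrow> rat"
    where q: "\<forall>t\<in>?J. of_rat (q t) < w t \<and> (\<forall>s<t. w s < of_rat (q t))"
    using bchoice[of ?J "\<lambda>t q. of_rat q < w t \<and> (\<forall>s<t. w s < of_rat q)"] by blast
  have less: "q s < q t" if "s \<in> ?J" "t \<in> ?J" "s < t" for s t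
  proof -
    have "(of_rat (q s) :: real) < of_rat (q t)"
      using q that less_trans[of "of_rat (q s)" "w s" "of_rat (q t)"] by blast
    then show ?thesis by (simp add: of_rat_less)
  qed
  have "inj_on q ?J"
  proof (rule inj_onI)
    fix s t assume "s \<in> ?J" "t \<in> ?J" "q s = q t"
    then show "s = t"
      using less[of s t] less[of t s] by (cases s t rule: linorder_cases) simp_all
  qed
  then show ?thesis
    by (rule countable_image_inj_on[OF countableI_type])
qed

text \<open>For every rational \<open>q\<close> one point suffices: the supremum of the points where \<open>w\<close> is below \<open>q\<close>.\<close>

lemma countable_hits_increments:
  fixes w :: "'a::linorder_topology \<Rightarrow> real"
  assumes K: "compact (UNIV :: 'a set)" and w: "mono w"
  obtains D where "countable D" "\<And>u v. w u < w v \<Longrightarrow> \<exists>d\<in>D. u \<le> d \<and> d \<le> v"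
proof -
  have "\<exists>m. \<forall>u v. w u < of_rat q \<and> of_rat q < w v \<longrightarrow> u \<le> m \<and> m \<le> v" for q
  proof (cases "{t. w t < of_rat q} = {}")
    case False
    then obtain m where m: "\<And>x. x \<in> {t. w t < of_rat q} \<Longrightarrow> x \<le> m"
      "\<And>u. u < m \<Longrightarrow> \<exists>x\<in>{t. w t < of_rat q}. u < x"
      using compact_line_Sup[OF K] by metis
    have "m \<le> v" if "of_rat q < w v" for v
    proof (rule ccontr)
      assume "\<not> m \<le> v"
      then obtain x where "w x < of_rat q" "v < x" using m(2)[of v] by (auto simp: not_le)
      then show False using monoD[OF w, of v x] that by (simp add: less_imp_le)
    qed
    then show ?thesis using m(1) by blast
  qed auto
  then obtain m where m: "\<And>q u v. w u < of_rat q \<Longrightarrow> of_rat q < w v \<Longrightarrow> u \<le> m q \<and> m q \<le> v"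
    by metis
  show thesis
  proof (rule that[of "range m"])
    show "\<exists>d\<in>range m. u \<le> d \<and> d \<le> v" if "w u < w v" for u v
      using of_rat_dense[OF that] m by blast
  qed auto
qed

section \<open>Shrinking intervals inside a separable \<open>G\<^sub>\<delta>\<close> set\<close>

text \<open>Two intervals overlap if they share two points.  The end points of \<open>E\<close> are exempt from being
  covered, because the pieces may meet there.\<close>

definition disjoint_refinement :: "('a::linorder \<times> 'a) set \<Rightarrow> ('a \<times> 'a) set \<Rightarrow> bool" where
  "disjoint_refinement E I \<longleftrightarrow> countable I \<and>
     (\<forall>(a, b)\<in>I. a < b \<and> (\<exists>(a', b')\<in>E. a' \<le> a \<and> b \<le> b')) \<and>
     (\<forall>s t. \<forall>p\<in>I. \<forall>q\<in>I. s < t \<longrightarrow> {s..t} \<subseteq> {fst p..snd p} \<longrightarrow> {s..t} \<subseteq> {fst q..snd q} \<longrightarrow> p = q) \<and>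
     (\<forall>t. (\<exists>(a, b)\<in>E. a < t \<and> t < b) \<longrightarrow> t \<notin> fst ` E \<union> snd ` E \<longrightarrow> (\<exists>(a, b)\<in>I. a < t \<and> t < b))"

text \<open>Intervals are added one at a time; each is cut at all end points seen so far, and a piece is
  kept only if it does not lie in an earlier interval.  A later piece has no end point of an
  earlier interval in its interior, hence lies inside that interval or does not overlap it.\<close>

lemma disjoint_refinement_exists:
  fixes E :: "('a::linorder \<times> 'a) set"
  assumes "countable E"
  shows "\<exists>I. disjoint_refinement E I"
proof (cases "E = {}")
  case True
  then show ?thesis by (intro exI[of _ "{}"]) (simp add: disjoint_refinement_def)
next
  case False
  define A where "A k = fst (from_nat_into E k)" for k
  define B where "B k = snd (from_nat_into E k)" for k
  define P where "P k = A ` {..k} \<union> B ` {..k}" for k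
  have AB: "(A k, B k) \<in> E" for k
    using from_nat_into[OF False, of k] by (simp add: A_def B_def)
  have E: "\<exists>k. (a, b) = (A k, B k)" if "(a, b) \<in> E" for a b
    using from_nat_into_surj[OF assms that] by (metis A_def B_def prod.collapse)
  have finP: "finite (P k)" for k
    by (simp add: P_def)
  define good where "good k a b \<longleftrightarrow> a \<in> P k \<and> b \<in> P k \<and> a < b \<and> {a<..<b} \<inter> P k = {} \<and>
      A k \<le> a \<and> b \<le> B k \<and> (\<forall>i<k. \<not> (A i \<le> a \<and> b \<le> B i))" for k a b
  have later: False if kl: "k < l" and g: "good k a b" "good l c d" and st: "s < t" "a \<le> s" "t \<le> b" "c \<le> s" "t \<le> d"
    for k l a b c d s t
  proof -
    have "A k \<in> P l" "B k \<in> P l" using kl by (auto simp: P_def)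
    moreover have "A k < d" "c < B k" using g st unfolding good_def by (meson le_less_trans less_le_trans order_trans)+
    ultimately have "A k \<le> c" "d \<le> B k"
      using g(2) unfolding good_def by (meson disjoint_iff greaterThanLessThan_iff not_le)+
    then show False using g(2) kl unfolding good_def by blast
  qed
  have same: "a = c \<and> b = d" if g: "good k a b" "good k c d" and st: "s < t" "a \<le> s" "t \<le> b" "c \<le> s" "t \<le> d"
    for k a b c d s t
  proof -
    have "a < d" "c < b" using st by (meson le_less_trans less_le_trans)+
    then have "\<not> a < c" "\<not> c < a" "\<not> b < d" "\<not> d < b"
      using g unfolding good_def by (meson disjoint_iff greaterThanLessThan_iff)+
    then show ?thesis by (simp add: not_less antisym)
  qed
  show ?thesis
    unfolding disjoint_refinement_def
  proof (intro exI[of _ "{(a, b). \<exists>k. good k a b}"] conjI ballI allI impI)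
    have "{(a, b). \<exists>k. good k a b} \<subseteq> (\<Union>k. P k) \<times> (\<Union>k. P k)"
      by (auto simp: good_def)
    then show "countable {(a, b). \<exists>k. good k a b}"
      by (rule countable_subset) (intro countable_SIGMA countable_UN countableI_type countable_finite finP)
    show "case z of (a, b) \<Rightarrow> a < b \<and> (\<exists>(a', b')\<in>E. a' \<le> a \<and> b \<le> b')" if "z \<in> {(a, b). \<exists>k. good k a b}" for z
      using that AB unfolding good_def by blast
    show "p = q" if pq': "p \<in> {(a, b). \<exists>k. good k a b}" "q \<in> {(a, b). \<exists>k. good k a b}"
      and pq: "s < t" "{s..t} \<subseteq> {fst p..snd p}" "{s..t} \<subseteq> {fst q..snd q}" for s t p q
    proof -
      obtain k l where g: "good k (fst p) (snd p)" "good l (fst q) (snd q)" using pq' by (auto simp: case_prod_beta)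
      have st: "fst p \<le> s" "t \<le> snd p" "fst q \<le> s" "t \<le> snd q"
        using pq by auto
      have "\<not> k < l" "\<not> l < k"
        using later[OF _ g pq(1)] later[OF _ g(2,1) pq(1)] st by blast+
      then have "k = l" by simp
      then show ?thesis using same[OF g(1) _ pq(1)] g(2) st by (simp add: prod_eq_iff)
    qed
    show "\<exists>(a, b)\<in>{(a, b). \<exists>k. good k a b}. a < t \<and> t < b"
      if "\<exists>(a, b)\<in>E. a < t \<and> t < b" "t \<notin> fst ` E \<union> snd ` E" for t
    proof -
      have "\<exists>k. A k < t \<and> t < B k" using that(1) E by fastforce
      define k where "k = (LEAST k. A k < t \<and> t < B k)"
      have k: "A k < t \<and> t < B k" "\<And>i. i < k \<Longrightarrow> \<not> (A i < t \<and> t < B i)"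
        unfolding k_def using LeastI_ex[OF \<open>\<exists>k. A k < t \<and> t < B k\<close>] not_less_Least by auto
      have tP: "t \<notin> P k" using that(2) AB by (force simp: P_def)
      define a where "a = Max {x\<in>P k. x < t}"
      define b where "b = Min {x\<in>P k. t < x}"
      have AP: "A k \<in> P k" "B k \<in> P k" by (auto simp: P_def)
      have fin: "finite {x\<in>P k. x < t}" "finite {x\<in>P k. t < x}" using finP[of k] by auto
      have ne: "{x\<in>P k. x < t} \<noteq> {}" "{x\<in>P k. t < x} \<noteq> {}" using AP k(1) by auto
      have a: "a \<in> {x\<in>P k. x < t}" "\<And>x. x \<in> P k \<Longrightarrow> x < t \<Longrightarrow> x \<le> a"
        unfolding a_def using Max_in[OF fin(1) ne(1)] Max_ge[OF fin(1)] by blast+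
      have b: "b \<in> {x\<in>P k. t < x}" "\<And>x. x \<in> P k \<Longrightarrow> t < x \<Longrightarrow> b \<le> x"
        unfolding b_def using Min_in[OF fin(2) ne(2)] Min_le[OF fin(2)] by blast+
      have "{a<..<b} \<inter> P k = {}"
      proof -
        have "x \<le> a \<or> b \<le> x" if "x \<in> P k" for x
          using a(2)[OF that] b(2)[OF that] tP that by (cases x t rule: linorder_cases) auto
        then show ?thesis by fastforce
      qed
      then have "good k a b"
      proof -
        have "\<not> (A i \<le> a \<and> b \<le> B i)" if "i < k" for i
          using k(2)[OF that] a(1) b(1) by (auto dest: le_less_trans less_le_trans)
        then show ?thesis
          unfolding good_def using a b AP k \<open>{a<..<b} \<inter> P k = {}\<close> less_trans[of a t b] by auto
      qed
      then show ?thesis using a(1) b(1) by auto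
    qed
  qed
qed

text \<open>At level \<open>j\<close> the intervals lie in the first \<open>j\<close> open sets and avoid the first \<open>j\<close> points of the
  dense set.  An interval \<open>[s, t]\<close> contained in members of infinitely many levels would lie in \<open>A\<close>
  and miss the dense set, although \<open>s\<close> is a right limit point of \<open>A\<close>.\<close>

lemma thin_intervals:
  fixes F :: "nat \<Rightarrow> 'a::linorder_topology set"
  assumes F: "\<And>i. open (F i)" and A: "A = (\<Inter>i. F i)"
    and D: "countable D" "D \<subseteq> A" and dense: "\<And>U. open U \<Longrightarrow> U \<inter> A \<noteq> {} \<Longrightarrow> U \<inter> D \<noteq> {}"
    and lim: "\<And>x. x \<in> A \<Longrightarrow> two_sided_limit_point A x" and ne: "A - D \<noteq> {}"
  obtains a b :: "nat \<Rightarrow> 'a" where "\<forall>n. a n < b n" "\<forall>s t. s < t \<longrightarrow> finite {n. a n \<le> s \<and> t \<le> b n}"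
    "\<forall>t\<in>A - D. infinite {n. a n < t \<and> t < b n}"
proof -
  have "D \<noteq> {}" using dense[of UNIV] ne by auto
  define d where "d = from_nat_into D"
  have d: "range d = D" unfolding d_def using \<open>D \<noteq> {}\<close> D(1) by (rule range_from_nat_into)
  define E where "E j = {(a, b). a \<in> D \<and> b \<in> D \<and> a < b \<and> (\<forall>i\<le>j. {a..b} \<subseteq> F i \<and> d i \<notin> {a<..<b})}" for j
  have "countable (E j)" for j
    by (rule countable_subset[of _ "D \<times> D"]) (use D in \<open>auto simp: E_def\<close>)
  then have "\<forall>j. \<exists>I. disjoint_refinement (E j) I"
    using disjoint_refinement_exists by blast
  then obtain I where "\<forall>j. disjoint_refinement (E j) (I j)"
    by (rule choice[THEN exE])
  then have R: "disjoint_refinement (E j) (I j)" for j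
    by blast
  have I1: "countable (I j)" for j
    using R[of j] by (simp add: disjoint_refinement_def)
  have I2: "a < b \<and> (\<exists>(a', b')\<in>E j. a' \<le> a \<and> b \<le> b')" if "(a, b) \<in> I j" for a b j
    using R[of j, unfolded disjoint_refinement_def, THEN conjunct2, THEN conjunct1, rule_format, OF that] by simp
  note I3 = R[unfolded disjoint_refinement_def, THEN conjunct2, THEN conjunct2, THEN conjunct1, rule_format]
  note I4 = R[unfolded disjoint_refinement_def, THEN conjunct2, THEN conjunct2, THEN conjunct2, rule_format]
  have cover: "\<exists>p\<in>I j. fst p < t \<and> t < snd p" if t: "t \<in> A - D" for j t
  proof -
    define N where "N = (\<Inter>i\<le>j. F i) - d ` {..j}"
    have N: "open N" "t \<in> N"
      unfolding N_def using F t A d by (auto intro!: open_Diff open_INT finite_imp_closed)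
    have ex: "\<exists>y. y < t" "\<exists>y. t < y" and l: "\<And>y. y < t \<Longrightarrow> {y<..<t} \<inter> A \<noteq> {}" "\<And>y. t < y \<Longrightarrow> {t<..<y} \<inter> A \<noteq> {}"
      using lim[of t] t unfolding two_sided_limit_point_def left_limit_point_def right_limit_point_def by blast+
    obtain u where u: "u < t" "{u<..t} \<subseteq> N"
      using ex(1) open_left[OF N] by blast
    obtain v where v: "t < v" "{t..<v} \<subseteq> N"
      using ex(2) open_right[OF N] by blast
    have "{u<..<t} \<inter> D \<noteq> {}" "{t<..<v} \<inter> D \<noteq> {}"
      using dense[OF open_greaterThanLessThan l(1)[OF u(1)]] dense[OF open_greaterThanLessThan l(2)[OF v(1)]] .
    then obtain a b where ab: "a \<in> D" "b \<in> D" "u < a" "a < t" "t < b" "b < v"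
      by auto
    have sub: "{a..b} \<subseteq> N"
    proof
      fix x assume "x \<in> {a..b}"
      then have "u < x" "x < v" using ab by (auto intro: less_le_trans le_less_trans)
      then have "x \<in> {u<..t} \<or> x \<in> {t..<v}" by auto
      then show "x \<in> N" using u(2) v(2) by blast
    qed
    have "d i \<notin> {a<..<b} \<and> {a..b} \<subseteq> F i" if "i \<le> j" for i
    proof -
      have "d i \<notin> N" "N \<subseteq> F i" using that by (auto simp: N_def)
      moreover have "{a<..<b} \<subseteq> {a..b}" by auto
      ultimately show ?thesis using sub by blast
    qed
    then have "(a, b) \<in> E j" unfolding E_def using ab by auto
    then have "\<exists>(a, b)\<in>I j. a < t \<and> t < b"
      using ab t by (intro I4) (auto simp: E_def)
    then show ?thesis by force
  qed
  define II where "II = Sigma UNIV I"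
  have cII: "countable II" unfolding II_def using I1 by (intro countable_SIGMA) auto
  have many: "infinite {z\<in>II. fst (snd z) < t \<and> t < snd (snd z)}" if "t \<in> A - D" for t
  proof
    assume fin: "finite {z\<in>II. fst (snd z) < t \<and> t < snd (snd z)}"
    have "j \<in> fst ` {z\<in>II. fst (snd z) < t \<and> t < snd (snd z)}" for j
      using cover[OF that, of j] by (force simp: II_def image_iff)
    then have "(UNIV :: nat set) \<subseteq> fst ` {z\<in>II. fst (snd z) < t \<and> t < snd (snd z)}" by blast
    then have "finite (UNIV :: nat set)" using fin finite_imageI finite_subset by blast
    then show False by simp
  qed
  obtain t0 where "t0 \<in> A - D" using ne by blast
  have "infinite II"
  proof
    assume "finite II"
    then have "finite {z\<in>II. fst (snd z) < t0 \<and> t0 < snd (snd z)}" by simp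
    then show False using many[OF \<open>t0 \<in> A - D\<close>] by blast
  qed
  define e where "e = from_nat_into II"
  have inj: "inj e" and ran: "range e = II"
    using bij_betw_from_nat_into[OF cII \<open>infinite II\<close>] by (auto simp: e_def bij_betw_def)
  show thesis
  proof (intro that[of "\<lambda>n. fst (snd (e n))" "\<lambda>n. snd (snd (e n))"] allI impI ballI)
    show "fst (snd (e n)) < snd (snd (e n))" for n
    proof -
      have "snd (e n) \<in> I (fst (e n))" using ran rangeI[of e n] by (auto simp: II_def)
      then show ?thesis using I2[of "fst (snd (e n))" "snd (snd (e n))"] by simp
    qed
    show "infinite {n. fst (snd (e n)) < t \<and> t < snd (snd (e n))}" if "t \<in> A - D" for t
    proof
      assume "finite {n. fst (snd (e n)) < t \<and> t < snd (snd (e n))}"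
      then have "finite (e ` {n. fst (snd (e n)) < t \<and> t < snd (snd (e n))})" by simp
      moreover have "{z\<in>II. fst (snd z) < t \<and> t < snd (snd z)} \<subseteq> e ` {n. fst (snd (e n)) < t \<and> t < snd (snd (e n))}"
        using ran by auto
      ultimately show False using many[OF that] finite_subset by blast
    qed
    show "finite {n. fst (snd (e n)) \<le> s \<and> t \<le> snd (snd (e n))}" if "s < t" for s t
    proof (rule ccontr)
      define M where "M = {n. fst (snd (e n)) \<le> s \<and> t \<le> snd (snd (e n))}"
      assume "infinite {n. fst (snd (e n)) \<le> s \<and> t \<le> snd (snd (e n))}"
      then have "infinite M" by (simp add: M_def)
      moreover have "inj_on (\<lambda>n. fst (e n)) M"
      proof (rule inj_onI)
        fix m n assume mn: "m \<in> M" "n \<in> M" "fst (e m) = fst (e n)"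
        have "snd (e m) \<in> I (fst (e m))" "snd (e n) \<in> I (fst (e m))"
          using ran rangeI[of e m] rangeI[of e n] mn(3) by (auto simp: II_def)
        then have "snd (e m) = snd (e n)"
          using mn(1,2) that by (intro I3[of _ _ _ s t]) (auto simp: M_def)
        then have "e m = e n" using mn(3) by (simp add: prod_eq_iff)
        then show "m = n" using inj by (simp add: inj_eq)
      qed
      ultimately have "infinite ((\<lambda>n. fst (e n)) ` M)"
        using finite_image_iff by blast
      then have unb: "\<exists>n\<in>M. i \<le> fst (e n)" for i
        unfolding infinite_nat_iff_unbounded_le by blast
      have key: "{s..t} \<subseteq> F i \<and> d i \<notin> {s<..<t}" for i
      proof -
        obtain n where n: "n \<in> M" "i \<le> fst (e n)" using unb by blast
        have "(fst (snd (e n)), snd (snd (e n))) \<in> I (fst (e n))"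
          using ran rangeI[of e n] by (auto simp: II_def)
        then obtain a' b' where ab: "(a', b') \<in> E (fst (e n))" "a' \<le> fst (snd (e n))" "snd (snd (e n)) \<le> b'"
          using I2 by blast
        then have "a' \<le> s" "t \<le> b'" using n(1) by (auto simp: M_def)
        then have "{s..t} \<subseteq> {a'..b'}" "{s<..<t} \<subseteq> {a'<..<b'}"
          by (auto intro: order_trans le_less_trans less_le_trans)
        moreover have "{a'..b'} \<subseteq> F i \<and> d i \<notin> {a'<..<b'}"
          using ab(1) n(2) by (auto simp: E_def)
        ultimately show ?thesis by blast
      qed
      have "s \<in> {s..t}" using that by simp
      then have "s \<in> A" using A key by blast
      then have "{s<..<t} \<inter> A \<noteq> {}"
        using lim[of s] that unfolding two_sided_limit_point_def right_limit_point_def by blast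
      then have "{s<..<t} \<inter> D \<noteq> {}" by (intro dense) auto
      then show False using key d by blast
    qed
  qed
qed

text \<open>Only steps need to be considered, since their span is dense.\<close>

lemma apply_bcontfun_diff_tendsto_0:
  fixes a b :: "nat \<Rightarrow> 'a::linorder_topology"
  assumes K: "compact (UNIV :: 'a set)" and ab: "\<forall>n. a n < b n"
    and fin: "\<forall>s t. s < t \<longrightarrow> finite {n. a n \<le> s \<and> t \<le> b n}"
  shows "(\<lambda>n. apply_bcontfun f (a n) - apply_bcontfun f (b n)) \<longlonglongrightarrow> (0::real)"
proof -
  define Z where "Z = {f. (\<lambda>n. apply_bcontfun f (a n) - apply_bcontfun f (b n)) \<longlonglongrightarrow> (0::real)}"
  have "subspace Z"
  proof (rule subspaceI)
    show "f + g \<in> Z" if "f \<in> Z" "g \<in> Z" for f g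
      using that tendsto_add[of "\<lambda>n. f (a n) - f (b n)" 0 _ "\<lambda>n. g (a n) - g (b n)" 0]
      by (simp add: Z_def algebra_simps)
    show "c *\<^sub>R f \<in> Z" if "f \<in> Z" for f c
      using that tendsto_mult_right[of "\<lambda>n. f (a n) - f (b n)" 0 _ c]
      by (simp add: Z_def algebra_simps)
  qed (simp add: Z_def)
  moreover have "step x y f \<Longrightarrow> f \<in> Z" for x y f
  proof -
    assume f: "step x y f"
    then have mf: "u \<le> v \<Longrightarrow> apply_bcontfun f u \<le> apply_bcontfun f v" for u v
      by (auto simp: step_def mono_def)
    \<comment> \<open>If the increment over \<open>[a\<^sub>n, b\<^sub>n]\<close> is large, it crosses one of finitely many levels
      \<open>[k/N, (k+1)/N]\<close>, and the points in between form a fixed interval inside \<open>[a\<^sub>n, b\<^sub>n]\<close>.\<close>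
    have cross: "finite {n. apply_bcontfun f (a n) \<le> c \<and> d \<le> apply_bcontfun f (b n)}" if "c < d" for c d
    proof (cases "{n. apply_bcontfun f (a n) \<le> c \<and> d \<le> apply_bcontfun f (b n)} = {}")
      case True
      then show ?thesis by (simp only: finite.emptyI)
    next
      case False
      then obtain n where n: "apply_bcontfun f (a n) \<le> c" "d \<le> apply_bcontfun f (b n)" by auto
      have "compact (apply_bcontfun f -` {..c})" "compact (apply_bcontfun f -` {d..})"
        using K compact_Int_closed[of UNIV] by (auto intro!: closed_vimage)
      then obtain x y where xy: "f x \<le> c" "\<And>u. f u \<le> c \<Longrightarrow> u \<le> x" "d \<le> f y" "\<And>u. d \<le> f u \<Longrightarrow> y \<le> u"
        using compact_attains_sup[of "apply_bcontfun f -` {..c}"] compact_attains_inf[of "apply_bcontfun f -` {d..}"] n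
        by (metis atLeast_iff atMost_iff emptyE vimage_eq)
      have "x < y" using mf[of y x] xy(1,3) \<open>c < d\<close> by (metis leD le_less_trans less_le_trans not_le)
      then show ?thesis
        using xy by (intro finite_subset[OF _ fin[rule_format, of x y]]) auto
    qed
    have "(\<lambda>n. apply_bcontfun f (a n) - apply_bcontfun f (b n)) \<longlonglongrightarrow> 0"
    proof (rule LIMSEQ_I)
      fix e :: real assume e: "0 < e"
      obtain N :: nat where N: "2 / e < N" using reals_Archimedean2 by blast
      then have N0: "0 < real N" using e by (metis divide_pos_pos less_trans zero_less_numeral)
      have "{n. e \<le> apply_bcontfun f (b n) - apply_bcontfun f (a n)} \<subseteq> (\<Union>k<N. {n. apply_bcontfun f (a n) \<le> real k / real N \<and> (real k + 1) / real N \<le> apply_bcontfun f (b n)})"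
      proof
        fix n assume "n \<in> {n. e \<le> apply_bcontfun f (b n) - apply_bcontfun f (a n)}"
        then have big: "e \<le> f (b n) - f (a n)" by simp
        have r: "0 \<le> real N * f (a n)" using step_range[OF f] by simp
        define k where "k = nat \<lceil>real N * f (a n)\<rceil>"
        have k: "real N * f (a n) \<le> real k" "real k < real N * f (a n) + 1"
          unfolding k_def using r by linarith+
        have "2 < real N * e" using N e by (simp add: field_simps)
        also have "\<dots> \<le> real N * f (b n) - real N * f (a n)"
          using big N0 mult_left_mono[OF big, of N] by (simp add: algebra_simps)
        finally have kb: "real k + 1 < real N * f (b n)" using k by linarith
        also have "\<dots> \<le> real N" using step_range[OF f, of "b n"] N0 by (simp add: mult_left_le)
        finally have "k < N" by simp
        moreover have "f (a n) \<le> real k / real N" "(real k + 1) / real N \<le> f (b n)"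
          using k kb N0 by (auto simp: field_simps)
        ultimately show "n \<in> (\<Union>k<N. {n. apply_bcontfun f (a n) \<le> real k / real N \<and> (real k + 1) / real N \<le> apply_bcontfun f (b n)})" by auto
      qed
      moreover have "finite (\<Union>k<N. {n. apply_bcontfun f (a n) \<le> real k / real N \<and> (real k + 1) / real N \<le> apply_bcontfun f (b n)})"
        using N0 by (intro finite_UN_I cross) (auto simp: divide_strict_right_mono)
      ultimately have "finite {n. e \<le> apply_bcontfun f (b n) - apply_bcontfun f (a n)}" by (rule finite_subset)
      then have "\<forall>\<^sub>F n in sequentially. \<not> e \<le> apply_bcontfun f (b n) - apply_bcontfun f (a n)"
        by (simp add: eventually_cofinite flip: cofinite_eq_sequentially)
      then have "\<forall>\<^sub>F n in sequentially. norm (f (a n) - f (b n) - 0) < e"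
        by eventually_elim (use mf[OF less_imp_le[OF ab[rule_format]]] in auto)
      then show "\<exists>no. \<forall>n\<ge>no. norm (f (a n) - f (b n) - 0) < e"
        by (simp add: eventually_sequentially)
    qed
    then show "f \<in> Z" by (simp add: Z_def)
  qed
  then have stepZ: "f \<in> Z" if "step x y f" for x y f using that .
  have "\<exists>h\<in>Z. (\<forall>u. 0 \<le> apply_bcontfun h u \<and> apply_bcontfun h u \<le> 1) \<and>
      (\<forall>u\<in>UNIV. (u \<le> x \<longrightarrow> h u = 0) \<and> (y \<le> u \<longrightarrow> h u = 1))" if xy: "x < y" for x y
  proof -
    obtain h where h: "step x y h" using step_exists[OF K xy] .
    then show ?thesis using stepZ[OF h] step_range[OF h] by (intro bexI[of _ h]) (auto simp: step_def)
  qed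
  moreover have "const_bcontfun c \<in> Z" for c by (simp add: Z_def)
  ultimately have dense: "\<exists>h\<in>Z. \<forall>u\<in>UNIV. \<bar>apply_bcontfun f u - apply_bcontfun h u\<bar> \<le> e" if "0 < e" for e
    using that by (intro steps_dense[OF K]) auto
  show ?thesis
  proof (rule LIMSEQ_I)
    fix e :: real assume e: "0 < e"
    then obtain h where h: "h \<in> Z" "\<And>u. \<bar>apply_bcontfun f u - apply_bcontfun h u\<bar> \<le> e/4"
      using dense[of "e/4"] by auto
    then obtain no where no: "\<And>n. no \<le> n \<Longrightarrow> \<bar>h (a n) - h (b n)\<bar> < e/4"
      using LIMSEQ_D[of "\<lambda>n. h (a n) - h (b n)" 0 "e/4"] e by (auto simp: Z_def)
    have "norm (f (a n) - f (b n) - 0) < e" if "no \<le> n" for n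
      using no[OF that] h(2)[of "a n"] h(2)[of "b n"] e unfolding real_norm_def by linarith
    then show "\<exists>no. \<forall>n\<ge>no. norm (f (a n) - f (b n) - 0) < e" by blast
  qed
qed

section \<open>Increasing surjections of compact lines\<close>

locale compact_line_surjection =
  fixes \<phi> :: "'k::linorder_topology \<Rightarrow> 'l::linorder_topology"
  assumes K: "compact (UNIV :: 'k set)" and L: "compact (UNIV :: 'l set)"
    and cont: "continuous_on UNIV \<phi>" and mono: "mono \<phi>" and surj: "surj \<phi>"
begin

lemma fibre_bounds: "\<exists>x y. \<phi> x = t \<and> \<phi> y = t \<and> (\<forall>z. \<phi> z = t \<longrightarrow> x \<le> z \<and> z \<le> y)"
proof -
  have "compact (\<phi> -` {t})"
    using K compact_Int_closed[of UNIV "\<phi> -` {t}"] cont by (simp add: closed_vimage)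
  moreover have "\<phi> -` {t} \<noteq> {}"
    using surj by (metis empty_iff insertI1 surjD vimageI2)
  ultimately show ?thesis
    using compact_attains_inf[of "\<phi> -` {t}"] compact_attains_sup[of "\<phi> -` {t}"] by blast
qed

definition lo :: "'l \<Rightarrow> 'k" where
  "lo t = (SOME x. \<phi> x = t \<and> (\<forall>z. \<phi> z = t \<longrightarrow> x \<le> z))"

definition hi :: "'l \<Rightarrow> 'k" where
  "hi t = (SOME y. \<phi> y = t \<and> (\<forall>z. \<phi> z = t \<longrightarrow> z \<le> y))"

lemma lo: "\<phi> (lo t) = t \<and> (\<forall>z. \<phi> z = t \<longrightarrow> lo t \<le> z)"
  unfolding lo_def by (rule someI_ex) (use fibre_bounds in blast)

lemma hi: "\<phi> (hi t) = t \<and> (\<forall>z. \<phi> z = t \<longrightarrow> z \<le> hi t)"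
  unfolding hi_def by (rule someI_ex) (use fibre_bounds in blast)

lemma \<phi>_less_imp: "\<phi> x < \<phi> y \<Longrightarrow> x < y"
  using mono by (meson linorder_not_le monoD)

lemma Q_iff: "t \<in> Q \<phi> \<longleftrightarrow> lo t < hi t"
proof
  assume "t \<in> Q \<phi>"
  then obtain x y where "\<phi> x = t" "\<phi> y = t" "x \<noteq> y" by (auto simp: Q_def)
  then show "lo t < hi t"
    using lo[of t] hi[of t] by (metis antisym_conv2 order_trans antisym)
next
  assume "lo t < hi t"
  then have "lo t \<in> \<phi> -` {t}" "hi t \<in> \<phi> -` {t}" "lo t \<noteq> hi t"
    using lo[of t] hi[of t] by auto
  then show "t \<in> Q \<phi>" unfolding Q_def by blast
qed

text \<open>A function that jumps from 0 to 1 inside the fibre over \<open>t\<close>.  Together with the range of the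
  pullback these functions span a subspace that is dense as far as values at end points of fibres
  are concerned, so an operator into \<open>c\<^sub>0\<close> is controlled by its values on them.\<close>

definition jump :: "'l \<Rightarrow> ('k \<Rightarrow>\<^sub>C real)" where
  "jump t = (SOME h. step (lo t) (hi t) h)"

lemma jump: "t \<in> Q \<phi> \<Longrightarrow> step (lo t) (hi t) (jump t)"
  unfolding jump_def Q_iff using step_exists[OF K, of "lo t" "hi t"] by (metis someI_ex)

lemma jump_below: "t \<in> Q \<phi> \<Longrightarrow> \<phi> x < t \<Longrightarrow> apply_bcontfun (jump t) x = 0"
  using jump[of t] \<phi>_less_imp[of x "lo t"] lo[of t] by (simp add: step_def)

lemma jump_above: "t \<in> Q \<phi> \<Longrightarrow> t < \<phi> x \<Longrightarrow> apply_bcontfun (jump t) x = 1"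
  using jump[of t] \<phi>_less_imp[of "hi t" x] hi[of t] by (simp add: step_def)

lemma apply_pull: "apply_bcontfun (pullback \<phi> f) x = apply_bcontfun f (\<phi> x)"
  by (rule apply_pullback[OF cont])

lemma jump_minus_pullback_norm:
  assumes "t \<in> Q \<phi>" "step x y f"
  shows "norm (jump t - pullback \<phi> f) \<le> 1"
proof (rule norm_bound)
  fix z
  show "norm (apply_bcontfun (jump t - pullback \<phi> f) z) \<le> 1"
    using step_range[OF jump[OF assms(1)], of z] step_range[OF assms(2), of "\<phi> z"]
    by (simp add: apply_pull abs_le_iff)
qed

text \<open>The difference of \<open>jump t\<close> and a step over \<open>[t, s]\<close> vanishes off the preimage of \<open>[t, s)\<close>.
  If a functional fails to be small on such differences for all \<open>s > t\<close>, its variation over the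
  preimage of \<open>(-\<infinity>, s)\<close> jumps at \<open>t\<close>.\<close>

lemma jump_eq_right_limit:
  fixes \<nu> :: "('k \<Rightarrow>\<^sub>C real) \<Rightarrow> real"
  assumes \<nu>: "bounded_linear \<nu>"
  shows "countable {t\<in>Q \<phi>. \<not> (\<forall>\<delta>>0. \<exists>s>t. \<forall>f. step t s f \<longrightarrow> \<bar>\<nu> (jump t) - \<nu> (pullback \<phi> f)\<bar> \<le> \<delta>)}"
    (is "countable ?V")
proof -
  define w where "w t = variation \<nu> {x. \<phi> x < t}" for t
  have "?V \<subseteq> {t. \<exists>\<delta>>0. \<forall>s>t. w t + \<delta> \<le> w s}"
  proof
    fix t assume t: "t \<in> ?V"
    then obtain \<delta> where \<delta>: "\<delta> > 0" "\<And>s. s > t \<Longrightarrow> \<exists>f. step t s f \<and> \<delta> < \<bar>\<nu> (jump t) - \<nu> (pullback \<phi> f)\<bar>"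
      unfolding mem_Collect_eq by (meson not_le)
    have "w t + \<delta> \<le> w s" if ts: "t < s" for s
    proof -
      obtain f where f: "step t s f" "\<delta> < \<bar>\<nu> (jump t) - \<nu> (pullback \<phi> f)\<bar>"
        using \<delta>(2)[OF ts] by blast
      have "w t + \<bar>\<nu> (jump t - pullback \<phi> f)\<bar> \<le> w s"
        unfolding w_def
      proof (rule variation_add[OF \<nu>, of _ "{x. t \<le> \<phi> x \<and> \<phi> x < s}"])
        show "norm (jump t - pullback \<phi> f) \<le> 1"
          using t f(1) by (intro jump_minus_pullback_norm) auto
        fix x assume "x \<notin> {x. t \<le> \<phi> x \<and> \<phi> x < s}"
        then have "\<phi> x < t \<or> s \<le> \<phi> x" by auto
        then show "apply_bcontfun (jump t - pullback \<phi> f) x = 0"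
        proof
          assume "\<phi> x < t"
          then show ?thesis
            using jump_below[of t x] f(1) t by (simp add: apply_pull step_def)
        next
          assume "s \<le> \<phi> x"
          moreover then have "t < \<phi> x" using ts by simp
          ultimately show ?thesis
            using jump_above[of t x] f(1) t by (simp add: apply_pull step_def)
        qed
      qed (use ts in auto)
      then show ?thesis using f(2) linear_diff[OF bounded_linear.linear[OF \<nu>]] by simp
    qed
    then show "t \<in> {t. \<exists>\<delta>>0. \<forall>s>t. w t + \<delta> \<le> w s}" using \<delta>(1) by blast
  qed
  then show ?thesis
    using countable_right_jumps countable_subset by blast
qed

text \<open>The mirror image, in which the variation over the preimage of \<open>(-\<infinity>, s]\<close> jumps.\<close>

lemma jump_eq_left_limit:
  fixes \<nu> :: "('k \<Rightarrow>\<^sub>C real) \<Rightarrow> real"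
  assumes \<nu>: "bounded_linear \<nu>"
  shows "countable {t\<in>Q \<phi>. \<not> (\<forall>\<delta>>0. \<exists>s<t. \<forall>f. step s t f \<longrightarrow> \<bar>\<nu> (jump t) - \<nu> (pullback \<phi> f)\<bar> \<le> \<delta>)}"
    (is "countable ?V")
proof -
  define w where "w t = variation \<nu> {x. \<phi> x \<le> t}" for t
  have "?V \<subseteq> {t. \<exists>\<delta>>0. \<forall>s<t. w s + \<delta> \<le> w t}"
  proof
    fix t assume t: "t \<in> ?V"
    then obtain \<delta> where \<delta>: "\<delta> > 0" "\<And>s. s < t \<Longrightarrow> \<exists>f. step s t f \<and> \<delta> < \<bar>\<nu> (jump t) - \<nu> (pullback \<phi> f)\<bar>"
      unfolding mem_Collect_eq by (meson not_le)
    have "w s + \<delta> \<le> w t" if ts: "s < t" for s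
    proof -
      obtain f where f: "step s t f" "\<delta> < \<bar>\<nu> (jump t) - \<nu> (pullback \<phi> f)\<bar>"
        using \<delta>(2)[OF ts] by blast
      have "w s + \<bar>\<nu> (jump t - pullback \<phi> f)\<bar> \<le> w t"
        unfolding w_def
      proof (rule variation_add[OF \<nu>, of _ "{x. s < \<phi> x \<and> \<phi> x \<le> t}"])
        show "norm (jump t - pullback \<phi> f) \<le> 1"
          using t f(1) by (intro jump_minus_pullback_norm) auto
        fix x assume "x \<notin> {x. s < \<phi> x \<and> \<phi> x \<le> t}"
        then have "\<phi> x \<le> s \<or> t < \<phi> x" by auto
        then show "apply_bcontfun (jump t - pullback \<phi> f) x = 0"
        proof
          assume "\<phi> x \<le> s"
          moreover then have "\<phi> x < t" using ts by simp
          ultimately show ?thesis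
            using jump_below[of t x] f(1) t by (simp add: apply_pull step_def)
        next
          assume "t < \<phi> x"
          then show ?thesis
            using jump_above[of t x] f(1) t by (simp add: apply_pull step_def)
        qed
      qed (use ts in auto)
      then show ?thesis using f(2) linear_diff[OF bounded_linear.linear[OF \<nu>]] by simp
    qed
    then show "t \<in> {t. \<exists>\<delta>>0. \<forall>s<t. w s + \<delta> \<le> w t}" using \<delta>(1) by blast
  qed
  then show ?thesis
    using countable_left_jumps countable_subset by blast
qed

section \<open>An operator that cannot be extended over uncountably many jumps\<close>

lemma bounded_linear_coordinate:
  assumes "bounded_linear S"
  shows "bounded_linear (\<lambda>g. apply_bcontfun (S g :: nat \<Rightarrow>\<^sub>C real) n)"
proof -
  interpret bounded_linear S by fact
  obtain B where B: "\<And>g. norm (S g) \<le> norm g * B" using bounded by blast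
  show ?thesis
  proof (rule bounded_linear_intro[where K = B])
    show "norm (apply_bcontfun (S g) n) \<le> norm g * B" for g
      using norm_bounded[of "S g" n] B[of g] by (rule order_trans)
  qed (simp_all add: add scaleR)
qed

text \<open>The operator \<open>f \<mapsto> (f(a\<^sub>n) - f(b\<^sub>n))\<^sub>n\<close> takes the value \<open>-1\<close> at infinitely many \<open>n\<close> on steep
  steps at any given \<open>t \<in> A\<close> outside a countable set.  For all but countably many such \<open>t\<close> in
  \<open>Q \<phi>\<close>, an extension to \<open>C(K)\<close> must take nearly the same values on \<open>jump t\<close>, where
  it is required to tend to 0.\<close>

lemma c0_extension_imp_countable:
  assumes ext: "map_c0_extension_property \<phi>"
    and A: "separable_space (top_of_set A)" "gdelta A" and lim: "\<And>x. x \<in> A \<Longrightarrow> two_sided_limit_point A x"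
  shows "countable (A \<inter> Q \<phi>)"
proof -
  obtain D where D: "countable D" "D \<subseteq> A" "top_of_set A closure_of D = A"
    using A(1) by (auto simp: separable_space_def)
  have dense: "U \<inter> D \<noteq> {}" if U: "open U" "U \<inter> A \<noteq> {}" for U
  proof -
    obtain x where x: "x \<in> U" "x \<in> A" using U(2) by blast
    then have "x \<in> top_of_set A closure_of D" using D(3) by simp
    moreover have "openin (top_of_set A) (A \<inter> U)" using U(1) by (simp add: openin_open_Int)
    ultimately have "\<exists>y. y \<in> D \<and> y \<in> A \<inter> U"
      using x unfolding in_closure_of by blast
    then show ?thesis by blast
  qed
  obtain F :: "nat \<Rightarrow> 'l set" where F: "\<And>i. open (F i)" "A = (\<Inter>i. F i)"
    using A(2) by (auto elim!: gdelta.cases)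
  show ?thesis
  proof (cases "A - D = {}")
    case True
    then show ?thesis using D(1) by (metis Diff_eq_empty_iff countable_Int1 countable_subset)
  next
    case False
    obtain a b :: "nat \<Rightarrow> 'l" where ab: "\<forall>n. a n < b n" "\<forall>s t. s < t \<longrightarrow> finite {n. a n \<le> s \<and> t \<le> b n}"
      "\<forall>t\<in>A - D. infinite {n. a n < t \<and> t < b n}"
      by (rule thin_intervals[OF F(1) F(2) D(1,2) dense lim False])
    define u where "u f = (\<lambda>n. apply_bcontfun f (a n) - apply_bcontfun f (b n))" for f :: "'l \<Rightarrow>\<^sub>C real"
    have ubd: "\<bar>u f n\<bar> \<le> 2 * norm f" for f n
      using norm_bounded[of f "a n"] norm_bounded[of f "b n"] by (simp add: u_def)
    define T where "T g = (Bcontfun (u (inv (pullback \<phi>) g)) :: nat \<Rightarrow>\<^sub>C real)" for g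
    have ub: "u f \<in> bcontfun" for f
      using ubd by (intro bcontfun_normI[where b = "2 * norm f"]) auto
    interpret P: bounded_linear "pullback \<phi>"
      by (rule bounded_linear_pullback[OF cont surj])
    have injP: "inj (pullback \<phi>)"
      unfolding P.inj_iff_eq_0 by (metis norm_eq_zero norm_pullback[OF cont surj])
    have T: "apply_bcontfun (T (pullback \<phi> f)) = u f" for f
      by (simp add: T_def inv_f_f[OF injP] Bcontfun_inverse ub)
    have "bounded_operator_on (range (pullback \<phi>)) c0 T"
      unfolding bounded_operator_on_def
    proof (intro conjI)
      show "T ` range (pullback \<phi>) \<subseteq> c0"
        using apply_bcontfun_diff_tendsto_0[OF L ab(1,2)] by (auto simp: c0_def T u_def)
      show "\<forall>x\<in>range (pullback \<phi>). \<forall>y\<in>range (pullback \<phi>). T (x + y) = T x + T y"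
        by (auto intro!: bcontfun_eqI simp flip: P.add simp: T) (simp add: u_def)
      show "\<forall>r. \<forall>x\<in>range (pullback \<phi>). T (r *\<^sub>R x) = r *\<^sub>R T x"
        by (auto intro!: bcontfun_eqI simp flip: P.scaleR simp: T) (simp add: u_def algebra_simps)
      show "\<exists>B. \<forall>x\<in>range (pullback \<phi>). norm (T x) \<le> norm x * B"
        using ubd by (intro exI[of _ 2]) (auto intro!: norm_bound simp: T norm_pullback[OF cont surj] mult.commute)
    qed
    then obtain S where S: "bounded_operator_on UNIV c0 S" "\<And>f. S (pullback \<phi> f) = T (pullback \<phi> f)"
      using ext unfolding map_c0_extension_property_def c0_extension_property_def by blast
    then have Sbl: "bounded_linear S" and Sc0: "S g \<in> c0" for g
      by (auto simp: bounded_operator_on_UNIV)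
    define V where "V n = {t\<in>Q \<phi>. \<not> (\<forall>\<delta>>0. \<exists>s>t. \<forall>f. step t s f \<longrightarrow>
        \<bar>apply_bcontfun (S (jump t)) n - apply_bcontfun (S (pullback \<phi> f)) n\<bar> \<le> \<delta>)}" for n
    have "countable (V n)" for n
      unfolding V_def by (rule jump_eq_right_limit[OF bounded_linear_coordinate[OF Sbl]])
    then have "countable (D \<union> (\<Union>n. V n))"
      using D(1) by auto
    moreover have "A \<inter> Q \<phi> \<subseteq> D \<union> (\<Union>n. V n)"
    proof (rule ccontr)
      assume "\<not> A \<inter> Q \<phi> \<subseteq> D \<union> (\<Union>n. V n)"
      then obtain t where t: "t \<in> A - D" "t \<in> Q \<phi>" "\<And>n. t \<notin> V n" by blast
      have "apply_bcontfun (S (jump t)) \<longlonglongrightarrow> 0"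
        using Sc0 by (simp add: c0_def)
      then obtain N where N: "\<And>n. N \<le> n \<Longrightarrow> \<bar>apply_bcontfun (S (jump t)) n\<bar> < 1/2"
        using LIMSEQ_D[of _ 0 "1/2"] by fastforce
      obtain n where n: "N \<le> n" "a n < t" "t < b n"
        using ab(3)[rule_format, OF t(1)] unfolding infinite_nat_iff_unbounded_le by blast
      have "\<forall>\<delta>>0. \<exists>s>t. \<forall>f. step t s f \<longrightarrow>
          \<bar>apply_bcontfun (S (jump t)) n - apply_bcontfun (S (pullback \<phi> f)) n\<bar> \<le> \<delta>"
        using t(2) t(3)[of n] unfolding V_def by blast
      then obtain s where s: "t < s" "\<And>f. step t s f \<Longrightarrow>
          \<bar>apply_bcontfun (S (jump t)) n - apply_bcontfun (S (pullback \<phi> f)) n\<bar> \<le> 1/2"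
        by (meson zero_less_divide_1_iff zero_less_numeral)
      obtain f where f: "step t (min s (b n)) f"
        using step_exists[OF L, of t "min s (b n)"] s(1) n(3) by auto
      then have "step t s f" by (rule step_mono) auto
      then have "\<bar>apply_bcontfun (S (jump t)) n - u f n\<bar> \<le> 1/2"
        using s(2) by (simp add: S(2) T)
      moreover have "u f n = -1"
        using f n(2,3) by (simp add: u_def step_def)
      ultimately show False using N[OF n(1)] by linarith
    qed
    ultimately show ?thesis by (rule countable_subset[rotated])
  qed
qed

end

section \<open>The \<open>G\<^sub>\<delta>\<close> set of a weak*-null sequence\<close>

text \<open>Removing the points near which the set is countable on one side costs only countably many
  points, and the remaining points are limits of uncountably many points on either side, so that
  they stay two-sided limit points after the removal.\<close>

lemma two_sided_core:
  fixes F :: "nat \<Rightarrow> 'a::linorder_topology set"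
  assumes F: "\<And>i. open (F i)" and B: "B = (\<Inter>i. F i)" and D: "countable D"
    and lim: "\<And>t. t \<in> B \<Longrightarrow> two_sided_limit_point D t"
  shows "\<exists>A\<subseteq>B. gdelta A \<and> separable_space (top_of_set A) \<and> (\<forall>x\<in>A. two_sided_limit_point A x) \<and> countable (B - A)"
proof -
  have left: "\<exists>d\<in>D. s < d \<and> d < t" if "t \<in> B" "s < t" for s t
    using lim[OF that(1)] that(2) unfolding two_sided_limit_point_def left_limit_point_def by fastforce
  have right: "\<exists>d\<in>D. t < d \<and> d < s" if "t \<in> B" "t < s" for s t
    using lim[OF that(1)] that(2) unfolding two_sided_limit_point_def right_limit_point_def by fastforce
  have ex: "(\<exists>y. y < t) \<and> (\<exists>y. t < y)" if "t \<in> B" for t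
    using lim[OF that] by (auto simp: two_sided_limit_point_def left_limit_point_def right_limit_point_def)
  define P where "P d = {t\<in>B. d < t \<and> countable ({d<..<t} \<inter> B)}" for d
  define R where "R d = {t\<in>B. t < d \<and> countable ({t<..<d} \<inter> B)}" for d
  have "countable (P d)" for d
  proof -
    define Z where "Z = (\<Union>d'\<in>{d'\<in>D. countable ({d<..<d'} \<inter> B)}. {d<..<d'} \<inter> B)"
    define m where "m = {t\<in>P d. \<forall>u\<in>P d. u \<le> t}"
    have "countable Z" unfolding Z_def using D by (intro countable_UN) auto
    moreover have eq: "x = y" if "x \<in> m" "y \<in> m" for x y
      using that by (auto simp: m_def intro: antisym)
    obtain x where "m \<subseteq> {x}"
      using eq by (cases "m = {}") blast+
    then have "countable m"
      by (rule countable_subset) simp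
    moreover have "P d \<subseteq> m \<union> Z"
    proof
      fix t assume t: "t \<in> P d"
      show "t \<in> m \<union> Z"
      proof (cases "t \<in> m")
        case False
        then obtain u where u: "u \<in> P d" "t < u" using t by (auto simp: m_def not_le)
        then obtain d' where d': "d' \<in> D" "t < d'" "d' < u" using left[of u t] by (auto simp: P_def)
        have "{d<..<d'} \<inter> B \<subseteq> {d<..<u} \<inter> B" using d' by auto
        then have "countable ({d<..<d'} \<inter> B)" by (rule countable_subset) (use u(1) in \<open>simp add: P_def\<close>)
        moreover have "t \<in> {d<..<d'} \<inter> B" using t d' by (auto simp: P_def)
        ultimately show ?thesis using d'(1) unfolding Z_def by blast
      qed simp
    qed
    ultimately show ?thesis by (meson countable_Un countable_subset)
  qed
  moreover have "countable (R d)" for d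
  proof -
    define Z where "Z = (\<Union>d'\<in>{d'\<in>D. countable ({d'<..<d} \<inter> B)}. {d'<..<d} \<inter> B)"
    define m where "m = {t\<in>R d. \<forall>u\<in>R d. t \<le> u}"
    have "countable Z" unfolding Z_def using D by (intro countable_UN) auto
    moreover have eq: "x = y" if "x \<in> m" "y \<in> m" for x y
      using that by (auto simp: m_def intro: antisym)
    obtain x where "m \<subseteq> {x}"
      using eq by (cases "m = {}") blast+
    then have "countable m"
      by (rule countable_subset) simp
    moreover have "R d \<subseteq> m \<union> Z"
    proof
      fix t assume t: "t \<in> R d"
      show "t \<in> m \<union> Z"
      proof (cases "t \<in> m")
        case False
        then obtain u where u: "u \<in> R d" "u < t" using t by (auto simp: m_def not_le)
        then obtain d' where d': "d' \<in> D" "u < d'" "d' < t" using right[of u t] by (auto simp: R_def)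
        have "{d'<..<d} \<inter> B \<subseteq> {u<..<d} \<inter> B" using d' by auto
        then have "countable ({d'<..<d} \<inter> B)" by (rule countable_subset) (use u(1) in \<open>simp add: R_def\<close>)
        moreover have "t \<in> {d'<..<d} \<inter> B" using t d' by (auto simp: R_def)
        ultimately show ?thesis using d'(1) unfolding Z_def by blast
      qed simp
    qed
    ultimately show ?thesis by (meson countable_Un countable_subset)
  qed
  moreover define N where "N = (\<Union>d\<in>D. P d \<union> R d)"
  ultimately have cN: "countable N"
    using D by auto
  define A where "A = B - N"
  have lA: "\<exists>x\<in>A. s < x \<and> x < t" if t: "t \<in> A" "s < t" for s t
  proof -
    obtain d where d: "d \<in> D" "s < d" "d < t" using left t by (auto simp: A_def)
    then have "t \<notin> P d" using t by (auto simp: A_def N_def)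
    then have "uncountable ({d<..<t} \<inter> B)" using d t by (auto simp: P_def A_def)
    then have "\<not> {d<..<t} \<inter> B \<subseteq> N" using cN countable_subset by blast
    then obtain x where "x \<in> {d<..<t}" "x \<in> B" "x \<notin> N" by blast
    then show ?thesis using d(2) by (intro bexI[of _ x]) (auto simp: A_def)
  qed
  have rA: "\<exists>x\<in>A. t < x \<and> x < s" if t: "t \<in> A" "t < s" for s t
  proof -
    obtain d where d: "d \<in> D" "t < d" "d < s" using right t by (auto simp: A_def)
    then have "t \<notin> R d" using t by (auto simp: A_def N_def)
    then have "uncountable ({t<..<d} \<inter> B)" using d t by (auto simp: R_def A_def)
    then have "\<not> {t<..<d} \<inter> B \<subseteq> N" using cN countable_subset by blast
    then obtain x where "x \<in> {t<..<d}" "x \<in> B" "x \<notin> N" by blast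
    then show ?thesis using d(3) by (intro bexI[of _ x]) (auto simp: A_def)
  qed
  show ?thesis
  proof (intro exI[of _ A] conjI ballI)
    show "A \<subseteq> B" by (auto simp: A_def)
    have "B - A \<subseteq> N" by (auto simp: A_def)
    then show "countable (B - A)" using cN countable_subset by blast
    show "two_sided_limit_point A x" if "x \<in> A" for x
    proof -
      have "{y<..<x} \<inter> A \<noteq> {}" if "y < x" for y using lA[OF \<open>x \<in> A\<close> that] by auto
      moreover have "{x<..<y} \<inter> A \<noteq> {}" if "x < y" for y using rA[OF \<open>x \<in> A\<close> that] by auto
      ultimately show ?thesis
        using ex[of x] that
        by (simp add: two_sided_limit_point_def left_limit_point_def right_limit_point_def A_def)
    qed
    obtain c :: "nat \<Rightarrow> 'a set" where c: "\<And>i. closed (c i)" "(\<Union>i. c i) = N"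
    proof (cases "N = {}")
      case True
      then show thesis by (intro that[of "\<lambda>_. {}"]) auto
    next
      case False
      have "(\<Union>i. {from_nat_into N i}) = N"
        using range_from_nat_into[OF False cN] by auto
      then show thesis by (intro that[of "\<lambda>i. {from_nat_into N i}"]) auto
    qed
    have "A = (\<Inter>i. F i - c i)"
      using c(2) by (auto simp: A_def B)
    then show "gdelta A"
      using gdelta.intros[of "\<lambda>i. F i - c i"] F c(1) by (simp add: open_Diff)
    define e where "e p = (SOME x. x \<in> A \<inter> {fst p<..<snd p})" for p
    have e: "e (d, d') \<in> A \<inter> {d<..<d'}" if "A \<inter> {d<..<d'} \<noteq> {}" for d d'
      unfolding e_def fst_conv snd_conv some_in_eq by (rule that)
    define C where "C = e ` (D \<times> D) \<inter> A"
    have "x \<in> top_of_set A closure_of C" if "x \<in> A" for x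
      unfolding in_closure_of
    proof (intro conjI allI impI)
      show "x \<in> topspace (top_of_set A)" using that by simp
      fix T assume "x \<in> T \<and> openin (top_of_set A) T"
      then obtain U where U: "open U" "T = A \<inter> U" "x \<in> U" by (auto simp: openin_open)
      have xB: "x \<in> B" using that by (simp add: A_def)
      obtain b where b: "b < x" "{b<..x} \<subseteq> U" using open_left[OF U(1,3)] ex[OF xB] by blast
      obtain b' where b': "x < b'" "{x..<b'} \<subseteq> U" using open_right[OF U(1,3)] ex[OF xB] by blast
      obtain d where d: "d \<in> D" "b < d" "d < x" using left[OF xB b(1)] by blast
      obtain d' where d': "d' \<in> D" "x < d'" "d' < b'" using right[OF xB b'(1)] by blast
      have "x \<in> A \<inter> {d<..<d'}" using that d d' by auto
      then have ed: "e (d, d') \<in> A \<inter> {d<..<d'}" by (intro e) blast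
      then have "e (d, d') \<in> {b<..x} \<or> e (d, d') \<in> {x..<b'}" using d d' by auto
      then have "e (d, d') \<in> T" using ed b(2) b'(2) U(2) by blast
      moreover have "e (d, d') \<in> C" using ed d d' by (auto simp: C_def)
      ultimately show "\<exists>y. y \<in> C \<and> y \<in> T" by blast
    qed
    then have "top_of_set A closure_of C = topspace (top_of_set A)"
      using closure_of_subset_topspace[of "top_of_set A" C] by auto
    moreover have "countable C" "C \<subseteq> topspace (top_of_set A)"
      using D by (auto simp: C_def)
    ultimately show "separable_space (top_of_set A)"
      unfolding separable_space_def by blast
  qed
qed

text \<open>Seen as a measure, a functional takes on a step over \<open>[x, y]\<close> an average of the measures of the
  final segments that begin between \<open>x\<close> and \<open>y\<close>.  The bad set thus consists of the points that lie,
  for infinitely many \<open>n\<close>, in an open interval along which these measures are at least \<open>\<epsilon>\<close>; in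
  this form it is visibly a \<open>G\<^sub>\<delta>\<close> set.\<close>

definition bad_set :: "(nat \<Rightarrow> ('a::linorder_topology \<Rightarrow>\<^sub>C real) \<Rightarrow> real) \<Rightarrow> real \<Rightarrow> 'a set" where
  "bad_set \<mu> \<epsilon> = {t. infinite {n. \<exists>x y. x < t \<and> t < y \<and> (\<forall>f. step x y f \<longrightarrow> \<epsilon> \<le> \<mu> n f)}}"

text \<open>Where no variation of the functional lies between two steps, it cannot tell them apart.\<close>

lemma steps_eq_if_no_variation:
  fixes \<mu> :: "('a::linorder_topology \<Rightarrow>\<^sub>C real) \<Rightarrow> real"
  assumes \<mu>: "bounded_linear \<mu>" and uv: "u \<le> v" "variation \<mu> {..<u} = variation \<mu> {..<v}"
    and f: "step a b f" "u \<le> a" "b \<le> v" and g: "step c d g" "u \<le> c" "d \<le> v"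
  shows "\<mu> f = \<mu> g"
proof -
  have "variation \<mu> {..<u} + \<bar>\<mu> (f - g)\<bar> \<le> variation \<mu> {..<v}"
  proof (rule variation_add[OF \<mu>, of _ "{u..<v}"])
    show "norm (f - g) \<le> 1"
    proof (rule norm_bound)
      show "norm (apply_bcontfun (f - g) x) \<le> 1" for x
        using step_range[OF f(1), of x] step_range[OF g(1), of x] by (simp add: abs_le_iff)
    qed
    show "apply_bcontfun (f - g) x = 0" if "x \<notin> {u..<v}" for x
    proof (cases "x < u")
      case True
      then have "x \<le> a" "x \<le> c" using f(2) g(2) by auto
      then show ?thesis using f(1) g(1) by (simp add: step_def)
    next
      case False
      then have "b \<le> x" "d \<le> x" using f(3) g(3) that by auto
      then show ?thesis using f(1) g(1) by (simp add: step_def)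
    qed
  qed (use uv in auto)
  then show ?thesis
    using uv(2) linear_diff[OF bounded_linear.linear[OF \<mu>], of f g] by simp
qed

text \<open>The sequence being weak*-null, the intervals that witness membership in the bad set shrink to
  the point.  Hence every point is a limit of places where some \<open>\<mu> n\<close> has variation: otherwise
  infinitely many \<open>\<mu> n\<close> would be at least \<open>\<epsilon>\<close> on a fixed step close to the point.  Countably many
  points are enough to detect all variation.\<close>

lemma bad_set_core:
  fixes \<mu> :: "nat \<Rightarrow> ('a::linorder_topology \<Rightarrow>\<^sub>C real) \<Rightarrow> real"
  assumes L: "compact (UNIV :: 'a set)" and \<mu>: "\<And>n. bounded_linear (\<mu> n)"
    and null: "\<And>f. (\<lambda>n. \<mu> n f) \<longlonglongrightarrow> 0" and \<epsilon>: "0 < \<epsilon>"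
  shows "\<exists>A\<subseteq>bad_set \<mu> \<epsilon>. gdelta A \<and> separable_space (top_of_set A) \<and>
    (\<forall>x\<in>A. two_sided_limit_point A x) \<and> countable (bad_set \<mu> \<epsilon> - A)"
proof -
  define good where "good n x y \<longleftrightarrow> (\<forall>f. step x y f \<longrightarrow> \<epsilon> \<le> \<mu> n f)" for n x y
  have "\<exists>D. countable D \<and> (\<forall>u v. variation (\<mu> n) {..<u} < variation (\<mu> n) {..<v} \<longrightarrow> (\<exists>d\<in>D. u \<le> d \<and> d \<le> v))" for n
  proof -
    have "mono (\<lambda>u. variation (\<mu> n) {..<u})"
      by (intro monoI variation_mono[OF \<mu>]) auto
    then show ?thesis
      using countable_hits_increments[OF L] by metis
  qed
  then obtain D where D: "\<And>n. countable (D n)"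
    "\<And>n u v. variation (\<mu> n) {..<u} < variation (\<mu> n) {..<v} \<Longrightarrow> \<exists>d\<in>D n. u \<le> d \<and> d \<le> v"
    by metis
  define DD where "DD = (\<Union>n. D n)"
  have same: "\<mu> n f = \<mu> n g" if "u \<le> v" "{u..v} \<inter> DD = {}"
      "step a b f" "u \<le> a" "b \<le> v" "step c d g" "u \<le> c" "d \<le> v" for n f g u v a b c d
  proof -
    have "\<not> variation (\<mu> n) {..<u} < variation (\<mu> n) {..<v}"
    proof
      assume "variation (\<mu> n) {..<u} < variation (\<mu> n) {..<v}"
      then obtain d where "d \<in> D n" "u \<le> d" "d \<le> v" using D(2) by blast
      then have "d \<in> {u..v} \<inter> DD" by (auto simp: DD_def)
      then show False using that(2) by blast
    qed
    then have "variation (\<mu> n) {..<u} = variation (\<mu> n) {..<v}"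
      using variation_mono[OF \<mu>, of "{..<u}" "{..<v}" n] that(1) by auto
    then show ?thesis using that by (intro steps_eq_if_no_variation[OF \<mu>, of u v])
  qed
  have small: "\<forall>\<^sub>F n in sequentially. \<mu> n f < \<epsilon>" for f
    using order_tendstoD(2)[OF null \<epsilon>] .
  have frequent: "\<exists>\<^sub>F n in sequentially. \<exists>x y. x < t \<and> t < y \<and> good n x y" if "t \<in> bad_set \<mu> \<epsilon>" for t
    using that unfolding bad_set_def good_def by (simp add: frequently_cofinite flip: cofinite_eq_sequentially)
  have left: "\<exists>\<^sub>F n in sequentially. \<exists>x y. s < x \<and> x < t \<and> t < y \<and> good n x y \<and> \<mu> n f < \<epsilon>"
    if t: "t \<in> bad_set \<mu> \<epsilon>" "s < t" for s t f
  proof -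
    obtain g where g: "step s t g" using step_exists[OF L t(2)] .
    have "\<exists>\<^sub>F n in sequentially. (\<exists>x y. x < t \<and> t < y \<and> good n x y) \<and> (\<mu> n f < \<epsilon> \<and> \<mu> n g < \<epsilon>)"
      using frequently_eventually_frequently[OF frequent[OF t(1)] eventually_conj[OF small small]] .
    then show ?thesis
    proof (rule frequently_elim1)
      fix n assume "(\<exists>x y. x < t \<and> t < y \<and> good n x y) \<and> \<mu> n f < \<epsilon> \<and> \<mu> n g < \<epsilon>"
      then obtain x y where xy: "x < t" "t < y" "good n x y" "\<mu> n f < \<epsilon>" "\<mu> n g < \<epsilon>" by blast
      have "s < x"
      proof (rule ccontr)
        assume "\<not> s < x"
        then have "step x y g" using g xy(2) by (intro step_mono[OF g]) auto
        then show False using xy(3,5) by (auto simp: good_def not_le[symmetric])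
      qed
      then show "\<exists>x y. s < x \<and> x < t \<and> t < y \<and> good n x y \<and> \<mu> n f < \<epsilon>" using xy by blast
    qed
  qed
  have right: "\<exists>\<^sub>F n in sequentially. \<exists>x y. x < t \<and> t < y \<and> y < s \<and> good n x y \<and> \<mu> n f < \<epsilon>"
    if t: "t \<in> bad_set \<mu> \<epsilon>" "t < s" for s t f
  proof -
    obtain g where g: "step t s g" using step_exists[OF L t(2)] .
    have "\<exists>\<^sub>F n in sequentially. (\<exists>x y. x < t \<and> t < y \<and> good n x y) \<and> (\<mu> n f < \<epsilon> \<and> \<mu> n g < \<epsilon>)"
      using frequently_eventually_frequently[OF frequent[OF t(1)] eventually_conj[OF small small]] .
    then show ?thesis
    proof (rule frequently_elim1)
      fix n assume "(\<exists>x y. x < t \<and> t < y \<and> good n x y) \<and> \<mu> n f < \<epsilon> \<and> \<mu> n g < \<epsilon>"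
      then obtain x y where xy: "x < t" "t < y" "good n x y" "\<mu> n f < \<epsilon>" "\<mu> n g < \<epsilon>" by blast
      have "y < s"
      proof (rule ccontr)
        assume "\<not> y < s"
        then have "step x y g" using g xy(1) by (intro step_mono[OF g]) auto
        then show False using xy(3,5) by (auto simp: good_def not_le[symmetric])
      qed
      then show "\<exists>x y. x < t \<and> t < y \<and> y < s \<and> good n x y \<and> \<mu> n f < \<epsilon>" using xy by blast
    qed
  qed
  have bl: "\<exists>x. s < x \<and> x < t" if "t \<in> bad_set \<mu> \<epsilon>" "s < t" for s t
    using frequently_ex[OF left[OF that, of 0]] by blast
  have br: "\<exists>x. t < x \<and> x < s" if "t \<in> bad_set \<mu> \<epsilon>" "t < s" for s t
    using frequently_ex[OF right[OF that, of 0]] by blast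
  have lim: "two_sided_limit_point DD t" if t: "t \<in> bad_set \<mu> \<epsilon>" for t
    unfolding two_sided_limit_point_def left_limit_point_def right_limit_point_def
  proof (intro conjI allI impI)
    show "\<exists>y. y < t" "\<exists>y. t < y" using frequently_ex[OF frequent[OF t]] by blast+
    show "{s<..<t} \<inter> DD \<noteq> {}" if s: "s < t" for s
    proof
      assume no: "{s<..<t} \<inter> DD = {}"
      obtain z where z: "s < z" "z < t" using bl[OF t s] by blast
      obtain z' where z': "z < z'" "z' < t" using bl[OF t z(2)] by blast
      obtain f where f: "step z z' f" using step_exists[OF L z'(1)] .
      obtain n p y where p: "z < p" "p < t" "t < y" "good n p y" "\<mu> n f < \<epsilon>"
        using frequently_ex[OF left[OF t z(2), of f]] by blast
      obtain p' where p': "max p z' < p'" "p' < t" using bl[OF t, of "max p z'"] p(2) z'(2) by auto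
      obtain g where g: "step p p' g" using step_exists[OF L, of p p'] p'(1) by auto
      have "{z..p'} \<subseteq> {s<..<t}" using z(1) p'(2) by (auto intro: less_le_trans le_less_trans)
      then have "{z..p'} \<inter> DD = {}" using no by blast
      then have "\<mu> n f = \<mu> n g"
        using f g p p' z' by (intro same[of z p' z z' f p p' g]) auto
      moreover have "step p y g" using p p' by (intro step_mono[OF g]) auto
      ultimately show False using p(4,5) by (auto simp: good_def not_le[symmetric])
    qed
    show "{t<..<s} \<inter> DD \<noteq> {}" if s: "t < s" for s
    proof
      assume no: "{t<..<s} \<inter> DD = {}"
      obtain z' where z': "t < z'" "z' < s" using br[OF t s] by blast
      obtain z where z: "t < z" "z < z'" using br[OF t z'(1)] by blast
      obtain f where f: "step z z' f" using step_exists[OF L z(2)] .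
      obtain n p y where p: "p < t" "t < y" "y < z'" "good n p y" "\<mu> n f < \<epsilon>"
        using frequently_ex[OF right[OF t z'(1), of f]] by blast
      obtain p' where p': "t < p'" "p' < min y z" using br[OF t, of "min y z"] p(2) z(1) by auto
      obtain g where g: "step p' y g" using step_exists[OF L, of p' y] p'(2) by auto
      have "{p'..z'} \<subseteq> {t<..<s}" using z'(2) p'(1) by (auto intro: less_le_trans le_less_trans)
      then have "{p'..z'} \<inter> DD = {}" using no by blast
      then have "\<mu> n f = \<mu> n g"
        using f g p p' z by (intro same[of p' z' z z' f p' y g]) auto
      moreover have "step p y g" using p p' by (intro step_mono[OF g]) auto
      ultimately show False using p(4,5) by (auto simp: good_def not_le[symmetric])
    qed
  qed
  define F where "F m = (\<Union>n\<in>{m..}. \<Union>(x, y)\<in>{(x, y). good n x y}. {x<..<y})" for m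
  have "bad_set \<mu> \<epsilon> = (\<Inter>m. F m)"
    unfolding bad_set_def F_def good_def infinite_nat_iff_unbounded_le by fastforce
  moreover have "open (F m)" for m
    unfolding F_def by (auto intro!: open_UN)
  ultimately show ?thesis
    using lim D(1) by (intro two_sided_core[of F _ DD]) (auto simp: DD_def)
qed

section \<open>Extending operators by correcting countably many jumps\<close>

text \<open>Rescaling the parts of \<open>f\<close> below and above its value at \<open>t\<close> exhibits \<open>f\<close> as a convex
  combination of two shorter steps.\<close>

lemma step_split:
  fixes \<mu> :: "('a::linorder_topology \<Rightarrow>\<^sub>C real) \<Rightarrow> real"
  assumes \<mu>: "linear \<mu>" and f: "step x y f"
    and left: "\<And>g. step x t g \<Longrightarrow> e \<le> \<mu> g" and right: "\<And>g. step t y g \<Longrightarrow> e \<le> \<mu> g"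
  shows "e \<le> \<mu> f"
proof -
  define c where "c = apply_bcontfun f t"
  have mf: "u \<le> v \<Longrightarrow> apply_bcontfun f u \<le> apply_bcontfun f v" for u v
    using f by (auto simp: step_def mono_def)
  have r: "0 \<le> apply_bcontfun f u" "apply_bcontfun f u \<le> 1" for u
    using step_range[OF f] by auto
  have f0: "u \<le> x \<Longrightarrow> apply_bcontfun f u = 0" and f1: "y \<le> u \<Longrightarrow> apply_bcontfun f u = 1" for u
    using f by (auto simp: step_def)
  consider "c = 0" | "c = 1" | "0 < c" "c < 1" using r[of t] unfolding c_def by linarith
  then show ?thesis
  proof cases
    case 1
    then have "apply_bcontfun f u = 0" if "u \<le> t" for u
      using mf[OF that] r(1)[of u] by (simp add: c_def)
    then have "step t y f" using f by (simp add: step_def)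
    then show ?thesis by (rule right)
  next
    case 2
    then have "apply_bcontfun f u = 1" if "t \<le> u" for u
      using mf[OF that] r(2)[of u] by (simp add: c_def)
    then have "step x t f" using f by (simp add: step_def)
    then show ?thesis by (rule left)
  next
    case 3
    have "(\<lambda>u. min (apply_bcontfun f u) c / c) \<in> bcontfun"
      using 3 r by (intro bcontfun_normI[where b = 1] continuous_intros) (auto simp: abs_le_iff min_def field_simps)
    then obtain g where g: "apply_bcontfun g = (\<lambda>u. min (apply_bcontfun f u) c / c)"
      by (metis Bcontfun_inverse)
    have "(\<lambda>u. (max (apply_bcontfun f u) c - c) / (1 - c)) \<in> bcontfun"
    proof (intro bcontfun_normI[where b = 1] continuous_intros)
      show "norm ((max (apply_bcontfun f u) c - c) / (1 - c)) \<le> 1" for u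
        using 3 r(2)[of u] by (auto simp: max_def field_simps)
    qed (use 3 in auto)
    then obtain h where h: "apply_bcontfun h = (\<lambda>u. (max (apply_bcontfun f u) c - c) / (1 - c))"
      by (metis Bcontfun_inverse)
    have "step x t g"
      unfolding step_def g mono_def
    proof (intro conjI allI impI)
      show "min (apply_bcontfun f u) c / c \<le> min (apply_bcontfun f v) c / c" if "u \<le> v" for u v
        using 3 mf[OF that] by (intro divide_right_mono) auto
      show "min (apply_bcontfun f u) c / c = 0" if "u \<le> x" for u
        using 3 f0[OF that] by simp
      show "min (apply_bcontfun f u) c / c = 1" if "t \<le> u" for u
        using 3 mf[OF that] by (simp add: c_def[symmetric])
    qed
    then have "e \<le> \<mu> g" by (rule left)
    moreover have "step t y h"
      unfolding step_def h mono_def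
    proof (intro conjI allI impI)
      show "(max (apply_bcontfun f u) c - c) / (1 - c) \<le> (max (apply_bcontfun f v) c - c) / (1 - c)" if "u \<le> v" for u v
        using 3 mf[OF that] by (intro divide_right_mono) auto
      show "(max (apply_bcontfun f u) c - c) / (1 - c) = 0" if "u \<le> t" for u
        using 3 mf[OF that] by (simp add: c_def[symmetric])
      show "(max (apply_bcontfun f u) c - c) / (1 - c) = 1" if "y \<le> u" for u
        using 3 f1[OF that] by simp
    qed
    then have "e \<le> \<mu> h" by (rule right)
    moreover have "f = c *\<^sub>R g + (1 - c) *\<^sub>R h"
      by (rule bcontfun_eqI) (use 3 in \<open>simp add: g h min_def max_def\<close>)
    then have "\<mu> f = c * \<mu> g + (1 - c) * \<mu> h"
      by (simp add: linear_add[OF \<mu>] linear_scale[OF \<mu>])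
    moreover have "c * e + (1 - c) * e = e" by (simp add: algebra_simps)
    ultimately show ?thesis
      using 3 mult_left_mono[of e "\<mu> g" c] mult_left_mono[of e "\<mu> h" "1 - c"] by linarith
  qed
qed

context compact_line_surjection
begin

text \<open>End points of fibres are all that matters: \<open>\<phi>\<close> maps this set onto \<open>L\<close>, and functionals that
  are bounded by the supremum over it are determined by their values on the range of the pullback
  and on the jumps, however complicated the interiors of the fibres are.\<close>

definition ends :: "'k set" where
  "ends = range lo \<union> range hi"

lemma ends_cases: "u \<in> ends \<Longrightarrow> u = lo (\<phi> u) \<or> u = hi (\<phi> u)"
  using lo hi unfolding ends_def by (elim UnE imageE) simp_all

definition end_norm :: "('k \<Rightarrow>\<^sub>C real) \<Rightarrow> real" where
  "end_norm g = (SUP x\<in>ends. \<bar>apply_bcontfun g x\<bar>)"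

lemma end_norm_upper: "x \<in> ends \<Longrightarrow> \<bar>apply_bcontfun g x\<bar> \<le> end_norm g"
  unfolding end_norm_def using norm_bounded[of g] by (intro cSUP_upper bdd_aboveI2[of _ _ "norm g"]) auto

lemma end_norm_least: "(\<And>x. x \<in> ends \<Longrightarrow> \<bar>apply_bcontfun g x\<bar> \<le> c) \<Longrightarrow> end_norm g \<le> c"
  unfolding end_norm_def by (rule cSUP_least) (auto simp: ends_def)

lemma end_norm_le_norm: "end_norm g \<le> norm g"
  using norm_bounded[of g] by (intro end_norm_least) simp

lemma end_norm_nonneg: "0 \<le> end_norm g"
  using end_norm_upper[of "lo undefined" g] by (auto simp: ends_def)

lemma end_norm_minus: "end_norm (- g) = end_norm g"
  by (simp add: end_norm_def)

lemma sublinear_end_norm: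
  assumes "0 \<le> M"
  shows "sublinear (\<lambda>g. M * end_norm g)"
  unfolding sublinear_def
proof (intro conjI allI impI)
  fix g h
  have "end_norm (g + h) \<le> end_norm g + end_norm h"
  proof (rule end_norm_least)
    show "\<bar>apply_bcontfun (g + h) x\<bar> \<le> end_norm g + end_norm h" if "x \<in> ends" for x
      using end_norm_upper[OF that, of g] end_norm_upper[OF that, of h] by simp
  qed
  then show "M * end_norm (g + h) \<le> M * end_norm g + M * end_norm h"
    using mult_left_mono[OF _ assms] by (metis distrib_left)
next
  fix c :: real and g assume c: "0 < c"
  have "end_norm (c *\<^sub>R g) \<le> c * end_norm g"
    using c by (intro end_norm_least) (simp add: abs_mult end_norm_upper)
  then show "M * end_norm (c *\<^sub>R g) \<le> c * (M * end_norm g)"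
    using mult_left_mono[OF _ assms] by (metis mult.left_commute)
qed

lemma norm_le_end_norm_pullback: "norm f \<le> end_norm (pullback \<phi> f)"
proof (rule norm_bound)
  fix t
  show "norm (apply_bcontfun f t) \<le> end_norm (pullback \<phi> f)"
    using end_norm_upper[of "lo t" "pullback \<phi> f"] lo[of t] by (simp add: apply_pull ends_def)
qed

lemma linear_pullback: "linear (pullback \<phi>)"
  by (rule bounded_linear.linear[OF bounded_linear_pullback[OF cont surj]])

text \<open>Subtracting from each jump a step that ends where the next fibre of the finite set begins makes
  the supports disjoint, so the functionals are summably bounded on these differences; on the steps
  themselves they tend to 0.\<close>

lemma eventually_jump_sum_le:
  assumes lin: "\<And>n. linear (\<nu> n)" and bd: "\<And>n g. \<bar>\<nu> n g\<bar> \<le> M * norm g" and M: "0 \<le> M"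
    and null: "\<And>f. (\<lambda>n. \<nu> n (pullback \<phi> f)) \<longlonglongrightarrow> (0::real)"
    and F: "finite F" "F \<subseteq> Q \<phi>"
  shows "\<forall>\<^sub>F n in sequentially. (\<Sum>t\<in>F. \<bar>\<nu> n (jump t)\<bar>) \<le> M + 1"
proof -
  have "\<exists>f :: 'l \<Rightarrow>\<^sub>C real. (\<forall>u. 0 \<le> apply_bcontfun f u \<and> apply_bcontfun f u \<le> 1) \<and> (\<forall>u\<le>t. apply_bcontfun f u = 0) \<and>
      (\<forall>t'\<in>F. t < t' \<longrightarrow> (\<forall>u\<ge>t'. apply_bcontfun f u = 1))" for t
  proof (cases "{t'\<in>F. t < t'} = {}")
    case True
    then show ?thesis by (intro exI[of _ 0]) auto
  next
    case False
    define s where "s = Min {t'\<in>F. t < t'}"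
    have fin: "finite {t'\<in>F. t < t'}" using F(1) by simp
    have "t < s" using Min_in[OF fin False] by (simp add: s_def)
    then obtain f where f: "step t s f" using step_exists[OF L] by blast
    have "s \<le> t'" if "t' \<in> F" "t < t'" for t'
      unfolding s_def using that by (intro Min_le[OF fin]) simp
    then have "apply_bcontfun f u = 1" if "t' \<in> F" "t < t'" "t' \<le> u" for t' u
      using f that order_trans[of s t' u] by (simp add: step_def)
    then show ?thesis
      using f step_range[OF f] by (intro exI[of _ f]) (auto simp: step_def)
  qed
  then have "\<forall>t. \<exists>f :: 'l \<Rightarrow>\<^sub>C real. (\<forall>u. 0 \<le> apply_bcontfun f u \<and> apply_bcontfun f u \<le> 1) \<and> (\<forall>u\<le>t. apply_bcontfun f u = 0) \<and>
      (\<forall>t'\<in>F. t < t' \<longrightarrow> (\<forall>u\<ge>t'. apply_bcontfun f u = 1))" by blast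
  from choice[OF this] obtain f :: "'l \<Rightarrow> ('l \<Rightarrow>\<^sub>C real)" where f: "\<forall>t. (\<forall>u. 0 \<le> apply_bcontfun (f t) u \<and> apply_bcontfun (f t) u \<le> 1) \<and>
      (\<forall>u\<le>t. apply_bcontfun (f t) u = 0) \<and> (\<forall>t'\<in>F. t < t' \<longrightarrow> (\<forall>u\<ge>t'. apply_bcontfun (f t) u = 1))"
    by blast
  define d where "d t = jump t - pullback \<phi> (f t)" for t
  have d_le: "\<bar>apply_bcontfun (d t) x\<bar> \<le> 1" if "t \<in> F" for t x
  proof -
    have "0 \<le> apply_bcontfun (f t) (\<phi> x)" "apply_bcontfun (f t) (\<phi> x) \<le> 1" using f by auto
    moreover have "0 \<le> apply_bcontfun (jump t) x" "apply_bcontfun (jump t) x \<le> 1"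
      using step_range[OF jump, of t x] that F(2) by auto
    ultimately show ?thesis by (simp add: d_def apply_pull abs_le_iff)
  qed
  have d_below: "apply_bcontfun (d t) x = 0" if "t \<in> F" "\<phi> x < t" for t x
    using f jump_below[of t x] that F(2) by (auto simp: d_def apply_pull)
  have d_above: "apply_bcontfun (d t) x = 0" if "t \<in> F" "t' \<in> F" "t < t'" "t' \<le> \<phi> x" for t t' x
  proof -
    have "apply_bcontfun (f t) (\<phi> x) = 1" using f that by blast
    moreover have "t < \<phi> x" using that by simp
    ultimately show ?thesis using jump_above[of t x] that F(2) by (auto simp: d_def apply_pull)
  qed
  have disj: "apply_bcontfun (d t') x = 0" if "t \<in> F" "t' \<in> F" "t' \<noteq> t" "apply_bcontfun (d t) x \<noteq> 0" for t t' x
  proof -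
    have "t \<le> \<phi> x" using d_below[of t x] that by (metis not_le)
    moreover have "\<phi> x < t'" if "t < t'" using d_above[of t t' x] that \<open>t \<in> F\<close> \<open>t' \<in> F\<close> \<open>apply_bcontfun (d t) x \<noteq> 0\<close>
      by (metis not_le)
    ultimately show ?thesis
      using d_below[of t' x] d_above[of t' t x] that by (cases t t' rule: linorder_cases) auto
  qed
  have sum_d: "(\<Sum>t\<in>F. \<bar>\<nu> n (d t)\<bar>) \<le> M" for n
  proof -
    define g where "g = (\<Sum>t\<in>F. sgn (\<nu> n (d t)) *\<^sub>R d t)"
    have g: "apply_bcontfun g x = (\<Sum>t\<in>F. sgn (\<nu> n (d t)) * apply_bcontfun (d t) x)" for x
      unfolding g_def using F(1) by (induction F) auto
    have "norm g \<le> 1"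
    proof (rule norm_bound)
      fix x
      show "norm (apply_bcontfun g x) \<le> 1"
      proof (cases "\<exists>t\<in>F. apply_bcontfun (d t) x \<noteq> 0")
        case True
        then obtain t where t: "t \<in> F" "apply_bcontfun (d t) x \<noteq> 0" by blast
        have "(\<Sum>s\<in>F. sgn (\<nu> n (d s)) * apply_bcontfun (d s) x) = (\<Sum>s\<in>{t}. sgn (\<nu> n (d s)) * apply_bcontfun (d s) x)"
          using F(1) t disj by (intro sum.mono_neutral_right) auto
        then have "\<bar>apply_bcontfun g x\<bar> = \<bar>sgn (\<nu> n (d t))\<bar> * \<bar>apply_bcontfun (d t) x\<bar>"
          by (simp add: g abs_mult)
        also have "\<dots> \<le> 1 * 1"
          by (intro mult_mono d_le t) (auto simp: sgn_if)
        finally show ?thesis by simp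
      qed (simp add: g)
    qed
    have "(\<Sum>t\<in>F. \<bar>\<nu> n (d t)\<bar>) = \<nu> n g"
      by (simp add: g_def linear_sum[OF lin] linear_scale[OF lin] abs_sgn mult.commute)
    also have "\<dots> \<le> M * norm g" using bd[of n g] by linarith
    also have "\<dots> \<le> M * 1" using \<open>norm g \<le> 1\<close> M by (rule mult_left_mono)
    finally show ?thesis by simp
  qed
  have "(\<lambda>n. \<Sum>t\<in>F. \<bar>\<nu> n (pullback \<phi> (f t))\<bar>) \<longlonglongrightarrow> (\<Sum>t\<in>F. \<bar>0\<bar>)"
    by (intro tendsto_sum tendsto_rabs null)
  then have "\<forall>\<^sub>F n in sequentially. (\<Sum>t\<in>F. \<bar>\<nu> n (pullback \<phi> (f t))\<bar>) < 1"
    by (rule order_tendstoD(2)) simp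
  then show ?thesis
  proof eventually_elim
    case (elim n)
    have "(\<Sum>t\<in>F. \<bar>\<nu> n (jump t)\<bar>) \<le> (\<Sum>t\<in>F. \<bar>\<nu> n (d t)\<bar> + \<bar>\<nu> n (pullback \<phi> (f t))\<bar>)"
      by (intro sum_mono) (simp add: d_def linear_diff[OF lin])
    then show ?case using sum_d[of n] elim by (simp add: sum.distrib)
  qed
qed

text \<open>The range of the pullback and the jumps contain all the steps needed to approximate on the ends
  of fibres: between points of different fibres a step of \<open>L\<close> can be used, and within one fibre
  its jump.\<close>

lemma tendsto_0_if_on_generators:
  assumes lin: "\<And>n. linear (\<nu> n)" and bd: "\<And>n g. \<bar>\<nu> n g\<bar> \<le> M * end_norm g" and M: "0 < M"
    and null: "\<And>f. (\<lambda>n. \<nu> n (pullback \<phi> f)) \<longlonglongrightarrow> (0::real)"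
    and jumps: "\<And>t. t \<in> Q \<phi> \<Longrightarrow> (\<lambda>n. \<nu> n (jump t)) \<longlonglongrightarrow> 0"
  shows "(\<lambda>n. \<nu> n g) \<longlonglongrightarrow> 0"
proof -
  define Z where "Z = {g. (\<lambda>n. \<nu> n g) \<longlonglongrightarrow> 0}"
  have Z: "subspace Z"
  proof (rule subspaceI)
    show "g + h \<in> Z" if "g \<in> Z" "h \<in> Z" for g h
      using that tendsto_add[of "\<lambda>n. \<nu> n g" 0 _ "\<lambda>n. \<nu> n h" 0] by (simp add: Z_def linear_add[OF lin])
    show "c *\<^sub>R g \<in> Z" if "g \<in> Z" for g c
      using that tendsto_mult_left[of "\<lambda>n. \<nu> n g" 0 _ c] by (simp add: Z_def linear_scale[OF lin])
  qed (simp add: Z_def linear_0[OF lin])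
  have const: "const_bcontfun c \<in> Z" for c
  proof -
    have "const_bcontfun c = pullback \<phi> (const_bcontfun c)"
      by (rule bcontfun_eqI) (simp add: apply_pull)
    then show ?thesis using null by (simp add: Z_def)
  qed
  have steps: "\<exists>h\<in>Z. (\<forall>u. 0 \<le> apply_bcontfun h u \<and> apply_bcontfun h u \<le> 1) \<and>
      (\<forall>u\<in>ends. (u \<le> x \<longrightarrow> apply_bcontfun h u = 0) \<and> (y \<le> u \<longrightarrow> apply_bcontfun h u = 1))" if xy: "x < y" for x y
  proof (cases "\<phi> x = \<phi> y")
    case False
    then have "\<phi> x < \<phi> y" using monoD[OF mono, of x y] xy by (simp add: order_less_le)
    then obtain f where f: "step (\<phi> x) (\<phi> y) f" using step_exists[OF L] by blast
    have "apply_bcontfun (pullback \<phi> f) u = 0" if "u \<le> x" for u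
      using f monoD[OF mono that] by (simp add: apply_pull step_def)
    moreover have "apply_bcontfun (pullback \<phi> f) u = 1" if "y \<le> u" for u
      using f monoD[OF mono that] by (simp add: apply_pull step_def)
    moreover have "pullback \<phi> f \<in> Z" using null by (simp add: Z_def)
    ultimately show ?thesis
      using step_range[OF f] by (intro bexI[of _ "pullback \<phi> f"]) (auto simp: apply_pull)
  next
    case True
    define t where "t = \<phi> x"
    have b: "lo t \<le> x" "y \<le> hi t" using lo[of t] hi[of t] True by (auto simp: t_def)
    then have t: "t \<in> Q \<phi>" using xy by (simp add: Q_iff)
    have "u \<le> lo t" if u: "u \<in> ends" "u \<le> x" for u
    proof -
      have "\<phi> u \<le> t" using monoD[OF mono u(2)] by (simp add: t_def)
      then consider "\<phi> u < t" | "u = lo t" | "u = hi t"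
        using ends_cases[OF u(1)] by (auto simp: order_le_less)
      then show ?thesis
        using \<phi>_less_imp[of u "lo t"] lo[of t] b xy u(2) by cases auto
    qed
    moreover have "hi t \<le> u" if u: "u \<in> ends" "y \<le> u" for u
    proof -
      have "t \<le> \<phi> u" using monoD[OF mono u(2)] True by (simp add: t_def)
      then consider "t < \<phi> u" | "u = lo t" | "u = hi t"
        using ends_cases[OF u(1)] by (auto simp: order_le_less)
      then show ?thesis
        using \<phi>_less_imp[of "hi t" u] hi[of t] b xy u(2) by cases auto
    qed
    moreover have "jump t \<in> Z" using jumps[OF t] by (simp add: Z_def)
    ultimately show ?thesis
      using jump[OF t] step_range[OF jump[OF t]] by (intro bexI[of _ "jump t"]) (auto simp: step_def)
  qed
  show ?thesis
  proof (rule LIMSEQ_I)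
    fix e :: real assume e: "0 < e"
    then have "0 < e / (2 * M)" using M by simp
    then obtain h where h: "h \<in> Z" "\<forall>u\<in>ends. \<bar>apply_bcontfun g u - apply_bcontfun h u\<bar> \<le> e / (2 * M)"
      using steps_dense[OF K Z const steps] by blast
    have "M * end_norm (g - h) \<le> M * (e / (2 * M))"
      using h(2) M by (intro mult_left_mono end_norm_least) auto
    then have gh: "M * end_norm (g - h) \<le> e / 2" using M by simp
    obtain no where no: "\<And>n. no \<le> n \<Longrightarrow> \<bar>\<nu> n h\<bar> < e / 2"
      using h(1) LIMSEQ_D[of "\<lambda>n. \<nu> n h" 0 "e/2"] e by (auto simp: Z_def)
    have "norm (\<nu> n g - 0) < e" if "no \<le> n" for n
      using no[OF that] bd[of n "g - h"] gh linear_diff[OF lin, of n g h] unfolding real_norm_def by linarith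
    then show "\<exists>no. \<forall>n\<ge>no. norm (\<nu> n g - 0) < e" by blast
  qed
qed

text \<open>If only countably many jumps are bad, they are corrected by point masses at the two ends of the
  fibres.  At stage \<open>n\<close> as many of them are corrected as the bound on the sum of the masses
  permits; every bad jump is corrected from some stage on.\<close>

lemma extension_if_countable_jumps:
  assumes lin: "\<And>n. linear (\<nu> n)" and bd: "\<And>n g. \<bar>\<nu> n g\<bar> \<le> M * end_norm g" and M: "0 \<le> M"
    and null: "\<And>f. (\<lambda>n. \<nu> n (pullback \<phi> f)) \<longlonglongrightarrow> (0::real)"
    and ctbl: "countable {t\<in>Q \<phi>. \<not> (\<lambda>n. \<nu> n (jump t)) \<longlonglongrightarrow> 0}"
  obtains S where "bounded_operator_on UNIV c0 S"
    "\<forall>f n. apply_bcontfun (S (pullback \<phi> f)) n = \<nu> n (pullback \<phi> f)"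
proof -
  define B where "B = {t\<in>Q \<phi>. \<not> (\<lambda>n. \<nu> n (jump t)) \<longlonglongrightarrow> 0}"
  define F where "F k = {b\<in>B. to_nat_on B b < k}" for k
  have finF: "finite (F k)" for k
  proof (rule inj_on_finite)
    show "inj_on (to_nat_on B) (F k)"
      using ctbl inj_on_to_nat_on[of B] by (auto simp: B_def F_def intro: inj_on_subset)
    show "to_nat_on B ` F k \<subseteq> {..<k}" by (auto simp: F_def)
  qed simp
  have FQ: "F k \<subseteq> Q \<phi>" for k by (auto simp: F_def B_def)
  define m where "m n = Max {k\<in>{..n}. (\<Sum>t\<in>F k. \<bar>\<nu> n (jump t)\<bar>) \<le> M + 1}" for n
  have m: "(\<Sum>t\<in>F (m n). \<bar>\<nu> n (jump t)\<bar>) \<le> M + 1"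
    "\<And>k. k \<le> n \<Longrightarrow> (\<Sum>t\<in>F k. \<bar>\<nu> n (jump t)\<bar>) \<le> M + 1 \<Longrightarrow> k \<le> m n" for n
  proof -
    have "0 \<in> {k\<in>{..n}. (\<Sum>t\<in>F k. \<bar>\<nu> n (jump t)\<bar>) \<le> M + 1}" using M by (simp add: F_def)
    then have "m n \<in> {k\<in>{..n}. (\<Sum>t\<in>F k. \<bar>\<nu> n (jump t)\<bar>) \<le> M + 1}"
      unfolding m_def by (intro Max_in) auto
    then show "(\<Sum>t\<in>F (m n). \<bar>\<nu> n (jump t)\<bar>) \<le> M + 1" by simp
    show "k \<le> m n" if "k \<le> n" "(\<Sum>t\<in>F k. \<bar>\<nu> n (jump t)\<bar>) \<le> M + 1" for k
      unfolding m_def using that by (intro Max_ge) auto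
  qed
  define \<nu>' where "\<nu>' n g = \<nu> n g - (\<Sum>t\<in>F (m n). \<nu> n (jump t) * (apply_bcontfun g (hi t) - apply_bcontfun g (lo t)))" for n g
  define C where "C = M + 2 * (M + 1)"
  have lin': "linear (\<nu>' n)" for n
  proof (rule linearI)
    show "\<nu>' n (g + h) = \<nu>' n g + \<nu>' n h" for g h
      by (simp add: \<nu>'_def linear_add[OF lin] algebra_simps sum.distrib sum_subtractf)
    show "\<nu>' n (c *\<^sub>R g) = c *\<^sub>R \<nu>' n g" for g c
      by (simp add: \<nu>'_def linear_scale[OF lin] algebra_simps sum_distrib_left sum_subtractf)
  qed
  have bd': "\<bar>\<nu>' n g\<bar> \<le> C * end_norm g" for n g
  proof -
    have "\<bar>\<Sum>t\<in>F (m n). \<nu> n (jump t) * (apply_bcontfun g (hi t) - apply_bcontfun g (lo t))\<bar>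
        \<le> (\<Sum>t\<in>F (m n). \<bar>\<nu> n (jump t)\<bar> * (2 * end_norm g))"
    proof (rule order_trans[OF sum_abs sum_mono])
      fix t
      have "\<bar>apply_bcontfun g (hi t) - apply_bcontfun g (lo t)\<bar> \<le> 2 * end_norm g"
        using end_norm_upper[of "hi t" g] end_norm_upper[of "lo t" g] by (simp add: ends_def)
      then show "\<bar>\<nu> n (jump t) * (apply_bcontfun g (hi t) - apply_bcontfun g (lo t))\<bar> \<le> \<bar>\<nu> n (jump t)\<bar> * (2 * end_norm g)"
        unfolding abs_mult by (rule mult_left_mono) simp
    qed
    also have "\<dots> = (\<Sum>t\<in>F (m n). \<bar>\<nu> n (jump t)\<bar>) * (2 * end_norm g)"
      by (simp add: sum_distrib_right)
    also have "\<dots> \<le> (M + 1) * (2 * end_norm g)"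
      using m(1) end_norm_nonneg by (intro mult_right_mono) auto
    finally show ?thesis
      using bd[of n g] unfolding \<nu>'_def C_def by (simp add: algebra_simps)
  qed
  have pull: "\<nu>' n (pullback \<phi> f) = \<nu> n (pullback \<phi> f)" for n f
    using lo hi by (simp add: \<nu>'_def apply_pull)
  have jumps: "(\<lambda>n. \<nu>' n (jump t)) \<longlonglongrightarrow> 0" if t: "t \<in> Q \<phi>" for t
  proof -
    have diff: "apply_bcontfun (jump t) (hi s) - apply_bcontfun (jump t) (lo s) = (if s = t then 1 else 0)" for s
    proof (cases s t rule: linorder_cases)
      case less
      then show ?thesis using jump_below[OF t, of "hi s"] jump_below[OF t, of "lo s"] lo hi by simp
    next
      case equal
      then show ?thesis using jump[OF t] by (simp add: step_def)
    next
      case greater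
      then show ?thesis using jump_above[OF t, of "hi s"] jump_above[OF t, of "lo s"] lo hi by simp
    qed
    have eq: "\<nu>' n (jump t) = \<nu> n (jump t) - (if t \<in> F (m n) then \<nu> n (jump t) else 0)" for n
    proof -
      have "(\<Sum>s\<in>F (m n). \<nu> n (jump s) * (apply_bcontfun (jump t) (hi s) - apply_bcontfun (jump t) (lo s)))
          = (\<Sum>s\<in>F (m n). if s = t then \<nu> n (jump s) else 0)"
        unfolding diff by (intro sum.cong) auto
      then show ?thesis using finF[of "m n"] by (simp add: \<nu>'_def sum.delta)
    qed
    show ?thesis
    proof (cases "t \<in> B")
      case False
      then have "\<nu>' n (jump t) = \<nu> n (jump t)" for n by (simp add: eq F_def)
      then show ?thesis using False t by (simp add: B_def)
    next
      case True
      define k where "k = Suc (to_nat_on B t)"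
      have "\<forall>\<^sub>F n in sequentially. (\<Sum>t\<in>F k. \<bar>\<nu> n (jump t)\<bar>) \<le> M + 1"
      proof (rule eventually_jump_sum_le[OF lin _ M null finF FQ])
        show "\<bar>\<nu> n g\<bar> \<le> M * norm g" for n g
          using bd[of n g] mult_left_mono[OF end_norm_le_norm M, of g] by linarith
      qed
      then have "\<forall>\<^sub>F n in sequentially. \<nu>' n (jump t) = 0"
        using eventually_ge_at_top[of k]
      proof eventually_elim
        case (elim n)
        then have "k \<le> m n" by (intro m(2))
        then have "t \<in> F (m n)" using True by (simp add: F_def k_def)
        then show ?case by (simp add: eq)
      qed
      then show ?thesis by (rule tendsto_eventually)
    qed
  qed
  have lim: "(\<lambda>n. \<nu>' n g) \<longlonglongrightarrow> 0" for g
    by (rule tendsto_0_if_on_generators[OF lin' bd' _ _ jumps]) (use M null in \<open>simp_all add: C_def pull\<close>)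
  have C: "\<bar>\<nu>' n g\<bar> \<le> C * norm g" for n g
  proof -
    have "C * end_norm g \<le> C * norm g"
      using M by (intro mult_left_mono end_norm_le_norm) (simp add: C_def)
    then show ?thesis using bd'[of n g] by linarith
  qed
  define S where "S g = (Bcontfun (\<lambda>n. \<nu>' n g) :: nat \<Rightarrow>\<^sub>C real)" for g
  have S: "apply_bcontfun (S g) = (\<lambda>n. \<nu>' n g)" for g
  proof -
    have "(\<lambda>n. \<nu>' n g) \<in> bcontfun"
      using C by (intro bcontfun_normI[where b = "C * norm g"]) auto
    then show ?thesis by (simp add: S_def Bcontfun_inverse)
  qed
  show thesis
  proof (rule that)
    have "bounded_linear S"
    proof (rule bounded_linear_intro[where K = C])
      show "norm (S g) \<le> norm g * C" for g
        using C by (intro norm_bound) (simp add: S mult.commute)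
    qed (auto intro!: bcontfun_eqI simp: S linear_add[OF lin'] linear_scale[OF lin'])
    then show "bounded_operator_on UNIV c0 S"
      using lim by (auto simp: bounded_operator_on_UNIV c0_def S)
    show "\<forall>f n. apply_bcontfun (S (pullback \<phi> f)) n = \<nu> n (pullback \<phi> f)"
      by (simp add: S pull)
  qed
qed

text \<open>If infinitely many \<open>\<nu> n (jump t)\<close> are at least \<open>2 \<epsilon>\<close> and these values are one-sided limits of
  values on steps from either side, then \<open>t\<close> is in the bad set.\<close>

lemma in_bad_set:
  assumes lin: "\<And>n. linear (\<nu> n)" and \<epsilon>: "0 < (\<epsilon>::real)"
    and right: "\<And>n \<delta>. 0 < \<delta> \<Longrightarrow> \<exists>s>t. \<forall>f. step t s f \<longrightarrow> \<bar>\<nu> n (jump t) - \<nu> n (pullback \<phi> f)\<bar> \<le> \<delta>"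
    and left: "\<And>n \<delta>. 0 < \<delta> \<Longrightarrow> \<exists>s<t. \<forall>f. step s t f \<longrightarrow> \<bar>\<nu> n (jump t) - \<nu> n (pullback \<phi> f)\<bar> \<le> \<delta>"
    and inf: "infinite {n. 2 * \<epsilon> \<le> \<nu> n (jump t)}"
  shows "t \<in> bad_set (\<lambda>n f. \<nu> n (pullback \<phi> f)) \<epsilon>"
proof -
  have "\<exists>x y. x < t \<and> t < y \<and> (\<forall>f. step x y f \<longrightarrow> \<epsilon> \<le> \<nu> n (pullback \<phi> f))" if n: "2 * \<epsilon> \<le> \<nu> n (jump t)" for n
  proof -
    obtain y where y: "t < y" "\<forall>f. step t y f \<longrightarrow> \<bar>\<nu> n (jump t) - \<nu> n (pullback \<phi> f)\<bar> \<le> \<epsilon>"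
      using right[OF \<epsilon>] by blast
    obtain x where x: "x < t" "\<forall>f. step x t f \<longrightarrow> \<bar>\<nu> n (jump t) - \<nu> n (pullback \<phi> f)\<bar> \<le> \<epsilon>"
      using left[OF \<epsilon>] by blast
    have "\<epsilon> \<le> \<nu> n (pullback \<phi> f)" if f: "step x y f" for f
    proof (rule step_split[OF _ f, where \<mu> = "\<lambda>f. \<nu> n (pullback \<phi> f)"])
      show "linear (\<lambda>f. \<nu> n (pullback \<phi> f))"
        using linear_compose[OF linear_pullback lin, of n] by (simp add: o_def)
      show "\<epsilon> \<le> \<nu> n (pullback \<phi> g)" if "step x t g" for g
        using x(2) that n by fastforce
      show "\<epsilon> \<le> \<nu> n (pullback \<phi> g)" if "step t y g" for g
        using y(2) that n by fastforce
    qed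
    then show ?thesis using x(1) y(1) by blast
  qed
  then have "{n. 2 * \<epsilon> \<le> \<nu> n (jump t)} \<subseteq> {n. \<exists>x y. x < t \<and> t < y \<and> (\<forall>f. step x y f \<longrightarrow> \<epsilon> \<le> \<nu> n (pullback \<phi> f))}"
    by blast
  then show ?thesis using inf finite_subset unfolding bad_set_def by blast
qed

text \<open>The coordinates of the operator form a weak*-null sequence on \<open>C(L)\<close>; any Hahn--Banach
  extensions of them that are dominated by the supremum over the ends of fibres can serve as a
  start.  Outside a countable set \<open>J\<close>, the value of each of them on a jump is a limit of values
  on steps from both sides, so the points of \<open>Q \<phi>\<close> where the values on the jump do not tend to
  0 lie in \<open>J\<close> or in countably many bad sets.  These meet \<open>Q \<phi>\<close> in countable sets by
  assumption, and countably many failures can be corrected.\<close>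

lemma c0_extension_if_countable:
  assumes ctbl: "\<And>A. separable_space (top_of_set A) \<Longrightarrow> gdelta A \<Longrightarrow> \<forall>x\<in>A. two_sided_limit_point A x \<Longrightarrow>
      countable (A \<inter> Q \<phi>)"
  shows "map_c0_extension_property \<phi>"
  unfolding map_c0_extension_property_def c0_extension_property_def
proof (intro allI impI)
  fix T assume T: "bounded_operator_on (range (pullback \<phi>)) c0 T"
  interpret P: bounded_linear "pullback \<phi>"
    by (rule bounded_linear_pullback[OF cont surj])
  define \<mu> where "\<mu> n f = apply_bcontfun (T (pullback \<phi> f)) n" for n f
  obtain B where B: "\<And>f. norm (T (pullback \<phi> f)) \<le> norm f * B"
    using T norm_pullback[OF cont surj] unfolding bounded_operator_on_def by (metis rangeI)
  define M where "M = \<bar>B\<bar>"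
  have M: "0 \<le> M" by (simp add: M_def)
  have \<mu>_le: "\<bar>\<mu> n f\<bar> \<le> M * norm f" for n f
  proof -
    have "\<bar>\<mu> n f\<bar> \<le> norm (T (pullback \<phi> f))"
      unfolding \<mu>_def using norm_bounded[of "T (pullback \<phi> f)" n] by simp
    also have "\<dots> \<le> norm f * B" by (rule B)
    also have "\<dots> \<le> norm f * M" unfolding M_def by (intro mult_left_mono) auto
    finally show ?thesis by (simp add: mult.commute)
  qed
  have Tadd: "T (pullback \<phi> (f + g)) = T (pullback \<phi> f) + T (pullback \<phi> g)" for f g
    using T unfolding bounded_operator_on_def P.add by blast
  have Tscale: "T (pullback \<phi> (c *\<^sub>R f)) = c *\<^sub>R T (pullback \<phi> f)" for c f
    using T unfolding bounded_operator_on_def P.scaleR by blast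
  have \<mu>_lin: "linear (\<mu> n)" for n
    by (rule linearI) (simp_all add: \<mu>_def Tadd Tscale)
  have null: "(\<lambda>n. \<mu> n f) \<longlonglongrightarrow> 0" for f
    using T by (auto simp: bounded_operator_on_def c0_def \<mu>_def)
  have "\<exists>q. linear q \<and> (\<forall>g. q g \<le> M * end_norm g) \<and> (\<forall>f. q (pullback \<phi> f) = \<mu> n f)" for n
  proof -
    have "\<mu> n f \<le> M * end_norm (pullback \<phi> f)" for f
      using \<mu>_le[of n f] mult_left_mono[OF norm_le_end_norm_pullback[of f] M] by linarith
    from Hahn_Banach[OF sublinear_end_norm[OF M] linear_pullback \<mu>_lin this]
    show ?thesis by metis
  qed
  then have "\<forall>n. \<exists>q. linear q \<and> (\<forall>g. q g \<le> M * end_norm g) \<and> (\<forall>f. q (pullback \<phi> f) = \<mu> n f)" by blast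
  from choice[OF this] obtain \<nu> where \<nu>: "\<forall>n. linear (\<nu> n) \<and> (\<forall>g. \<nu> n g \<le> M * end_norm g) \<and> (\<forall>f. \<nu> n (pullback \<phi> f) = \<mu> n f)"
    by blast
  have lin: "linear (\<nu> n)" and ext: "\<nu> n (pullback \<phi> f) = \<mu> n f" for n f using \<nu> by auto
  have bd: "\<bar>\<nu> n g\<bar> \<le> M * end_norm g" for n g
  proof -
    have "\<nu> n g \<le> M * end_norm g" "\<nu> n (- g) \<le> M * end_norm (- g)" using \<nu> by blast+
    then show ?thesis by (simp add: end_norm_minus linear_neg[OF lin] abs_le_iff)
  qed
  have \<nu>_bl: "bounded_linear (\<nu> n)" for n
  proof (rule bounded_linear_intro[where K = M])
    show "norm (\<nu> n g) \<le> norm g * M" for g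
      using bd[of n g] mult_left_mono[OF end_norm_le_norm M, of g] by (simp add: mult.commute)
  qed (simp_all add: linear_add[OF lin] linear_scale[OF lin])
  have \<mu>_bl: "bounded_linear (\<mu> n)" for n
  proof (rule bounded_linear_intro[where K = M])
    show "norm (\<mu> n f) \<le> norm f * M" for f
      using \<mu>_le[of n f] by (simp add: mult.commute)
  qed (simp_all add: linear_add[OF \<mu>_lin] linear_scale[OF \<mu>_lin])
  define VR where "VR n = {t\<in>Q \<phi>. \<not> (\<forall>\<delta>>0. \<exists>s>t. \<forall>f. step t s f \<longrightarrow> \<bar>\<nu> n (jump t) - \<nu> n (pullback \<phi> f)\<bar> \<le> \<delta>)}" for n
  define VL where "VL n = {t\<in>Q \<phi>. \<not> (\<forall>\<delta>>0. \<exists>s<t. \<forall>f. step s t f \<longrightarrow> \<bar>\<nu> n (jump t) - \<nu> n (pullback \<phi> f)\<bar> \<le> \<delta>)}" for n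
  define J where "J = (\<Union>n. VR n \<union> VL n)"
  have "countable J"
    unfolding J_def VR_def VL_def
    by (intro countable_UN countable_Un jump_eq_right_limit[OF \<nu>_bl] jump_eq_left_limit[OF \<nu>_bl] countableI_type)
  define \<epsilon> where "\<epsilon> k = 1 / (2 * real (Suc k))" for k
  have \<epsilon>: "0 < \<epsilon> k" for k by (simp add: \<epsilon>_def)
  have bad_ctbl: "countable (bad_set \<mu>' e \<inter> Q \<phi>)"
    if \<mu>': "\<And>n. bounded_linear (\<mu>' n)" "\<And>f. (\<lambda>n. \<mu>' n f) \<longlonglongrightarrow> 0" and e: "0 < e" for \<mu>' :: "nat \<Rightarrow> ('l \<Rightarrow>\<^sub>C real) \<Rightarrow> real" and e
  proof -
    obtain A where A: "gdelta A" "separable_space (top_of_set A)" "\<forall>x\<in>A. two_sided_limit_point A x"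
      "countable (bad_set \<mu>' e - A)"
      using bad_set_core[OF L \<mu>' e] by blast
    have "countable (A \<inter> Q \<phi> \<union> (bad_set \<mu>' e - A))"
      using ctbl[OF A(2,1,3)] A(4) by simp
    then show ?thesis by (rule countable_subset[rotated]) blast
  qed
  have "countable (bad_set \<mu> (\<epsilon> k) \<inter> Q \<phi>)" for k
    by (rule bad_ctbl[OF \<mu>_bl null \<epsilon>])
  moreover have "countable (bad_set (\<lambda>n f. - \<mu> n f) (\<epsilon> k) \<inter> Q \<phi>)" for k
  proof (rule bad_ctbl[OF bounded_linear_minus[OF \<mu>_bl] _ \<epsilon>])
    show "(\<lambda>n. - \<mu> n f) \<longlonglongrightarrow> 0" for f using tendsto_minus[OF null[of f]] by simp
  qed
  ultimately have "countable (J \<union> (\<Union>k. bad_set \<mu> (\<epsilon> k) \<inter> Q \<phi> \<union> bad_set (\<lambda>n f. - \<mu> n f) (\<epsilon> k) \<inter> Q \<phi>))"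
    using \<open>countable J\<close> by (intro countable_Un countable_UN countableI_type)
  moreover have "{t\<in>Q \<phi>. \<not> (\<lambda>n. \<nu> n (jump t)) \<longlonglongrightarrow> 0} \<subseteq>
      J \<union> (\<Union>k. bad_set \<mu> (\<epsilon> k) \<inter> Q \<phi> \<union> bad_set (\<lambda>n f. - \<mu> n f) (\<epsilon> k) \<inter> Q \<phi>)"
  proof
    fix t assume "t \<in> {t\<in>Q \<phi>. \<not> (\<lambda>n. \<nu> n (jump t)) \<longlonglongrightarrow> 0}"
    then have t: "t \<in> Q \<phi>" "\<not> (\<lambda>n. \<nu> n (jump t)) \<longlonglongrightarrow> 0" by auto
    show "t \<in> J \<union> (\<Union>k. bad_set \<mu> (\<epsilon> k) \<inter> Q \<phi> \<union> bad_set (\<lambda>n f. - \<mu> n f) (\<epsilon> k) \<inter> Q \<phi>)"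
    proof (cases "t \<in> J")
      case False
      then have right: "\<exists>s>t. \<forall>f. step t s f \<longrightarrow> \<bar>\<nu> n (jump t) - \<nu> n (pullback \<phi> f)\<bar> \<le> \<delta>" if "0 < \<delta>" for n \<delta>
        using t(1) that unfolding J_def VR_def by blast
      have left: "\<exists>s<t. \<forall>f. step s t f \<longrightarrow> \<bar>\<nu> n (jump t) - \<nu> n (pullback \<phi> f)\<bar> \<le> \<delta>" if "0 < \<delta>" for n \<delta>
        using False t(1) that unfolding J_def VL_def by blast
      \<comment> \<open>The bad sets detect large positive values only, hence the second family for \<open>- \<mu>\<close>.\<close>
      obtain e where e: "0 < e" "\<forall>no. \<exists>n\<ge>no. e \<le> \<bar>\<nu> n (jump t)\<bar>"
        using t(2) unfolding LIMSEQ_iff by (force simp: not_less)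
      obtain k where "inverse (real (Suc k)) < e" using reals_Archimedean[OF e(1)] by blast
      then have k: "2 * \<epsilon> k \<le> e" by (simp add: \<epsilon>_def field_simps)
      have "infinite {n. e \<le> \<bar>\<nu> n (jump t)\<bar>}"
        using e(2) by (simp add: infinite_nat_iff_unbounded_le)
      moreover have "{n. e \<le> \<bar>\<nu> n (jump t)\<bar>} \<subseteq> {n. 2 * \<epsilon> k \<le> \<nu> n (jump t)} \<union> {n. 2 * \<epsilon> k \<le> - \<nu> n (jump t)}"
        using k by auto
      ultimately consider "infinite {n. 2 * \<epsilon> k \<le> \<nu> n (jump t)}" | "infinite {n. 2 * \<epsilon> k \<le> - \<nu> n (jump t)}"
        by (meson finite_UnI finite_subset)
      then show ?thesis
      proof cases
        case 1
        then have "t \<in> bad_set (\<lambda>n f. \<nu> n (pullback \<phi> f)) (\<epsilon> k)"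
          using right left by (intro in_bad_set[OF lin \<epsilon>])
        then show ?thesis using t(1) by (auto simp: ext)
      next
        case 2
        have "t \<in> bad_set (\<lambda>n f. - \<nu> n (pullback \<phi> f)) (\<epsilon> k)"
        proof (rule in_bad_set[OF linear_compose_neg[OF lin] \<epsilon> _ _ 2])
          show "\<exists>s>t. \<forall>f. step t s f \<longrightarrow> \<bar>- \<nu> n (jump t) - - \<nu> n (pullback \<phi> f)\<bar> \<le> \<delta>" if "0 < \<delta>" for n \<delta>
            using right[OF that, of n] by (simp add: abs_minus_commute)
          show "\<exists>s<t. \<forall>f. step s t f \<longrightarrow> \<bar>- \<nu> n (jump t) - - \<nu> n (pullback \<phi> f)\<bar> \<le> \<delta>" if "0 < \<delta>" for n \<delta>
            using left[OF that, of n] by (simp add: abs_minus_commute)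
        qed
        then show ?thesis using t(1) by (auto simp: ext)
      qed
    qed simp
  qed
  ultimately have jumps_ctbl: "countable {t\<in>Q \<phi>. \<not> (\<lambda>n. \<nu> n (jump t)) \<longlonglongrightarrow> 0}"
    by (rule countable_subset[rotated])
  have null': "(\<lambda>n. \<nu> n (pullback \<phi> f)) \<longlonglongrightarrow> 0" for f
    using null by (simp add: ext)
  obtain S where S: "bounded_operator_on UNIV c0 S"
    "\<forall>f n. apply_bcontfun (S (pullback \<phi> f)) n = \<nu> n (pullback \<phi> f)"
    by (rule extension_if_countable_jumps[OF lin bd M null' jumps_ctbl])
  have "S (pullback \<phi> f) = T (pullback \<phi> f)" for f
    by (rule bcontfun_eqI) (simp add: S(2) ext \<mu>_def)
  then show "\<exists>S. bounded_operator_on UNIV c0 S \<and> (\<forall>y\<in>range (pullback \<phi>). S y = T y)"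
    using S(1) by blast
qed

end

theorem theorem2p6:
  fixes \<phi> :: "'k::linorder_topology \<Rightarrow> 'l::linorder_topology"
  assumes "compact (UNIV :: 'k set)"
    and "compact (UNIV :: 'l set)"
    and "continuous_on UNIV \<phi>"
    and "mono \<phi>"
    and "surj \<phi>"
  shows "map_c0_extension_property \<phi> \<longleftrightarrow>
    (\<forall>A :: 'l set.
       separable_space (top_of_set A) \<and> gdelta A \<and>
       (\<forall>x\<in>A. two_sided_limit_point A x) \<longrightarrow>
         A \<inter> Q \<phi> = A \<inter> Q0 \<phi> \<and> countable (A \<inter> Q \<phi>))"
proof -
  interpret compact_line_surjection \<phi>
    by unfold_locales (rule assms)+
  have internal: "A \<inter> Q \<phi> = A \<inter> Q0 \<phi>" if "\<forall>x\<in>A. two_sided_limit_point A x" for A :: "'l set"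
  proof -
    have "internal_point x" if "two_sided_limit_point A x" for x
      using that unfolding internal_point_def two_sided_limit_point_def left_limit_point_def right_limit_point_def
      by blast
    then show ?thesis using that by (auto simp: Q0_def)
  qed
  show ?thesis
  proof (intro iffI allI impI)
    fix A :: "'l set" assume "map_c0_extension_property \<phi>"
      and A: "separable_space (top_of_set A) \<and> gdelta A \<and> (\<forall>x\<in>A. two_sided_limit_point A x)"
    then have "countable (A \<inter> Q \<phi>)"
      by (intro c0_extension_imp_countable) auto
    then show "A \<inter> Q \<phi> = A \<inter> Q0 \<phi> \<and> countable (A \<inter> Q \<phi>)"
      using internal A by blast
  qed (rule c0_extension_if_countable, blast)
qed

end
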